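(* Let $(X,\nabla,g)$ be a compact Hessian manifold and $(X,\nabla',g)$ its dual. Up to affine isomorphism, $\nabla'$ only depends on the class of $g$. In other words, if $g'$ is another Hessian metric on $(X,\nabla)$ such that $g-g'=\nabla d\phi$ for a smooth function $\phi$ on $X$, then the dual of $(X,\nabla,g')$ is $(X,\nabla',g')$.
   Context: An affine structure on a smooth manifold $X$ of dimension $d\ge1$ is a flat torsion-free connection $\nabla$ on the tangent bundle of $X$ (equivalently, an atlas whose transition functions are affine; its charts give affine coordinates). An affine isomorphism between affine manifolds is a diffeomorphism carrying one connection to the other. A Hessian metric on $(X,\nabla)$ is a Riemannian metric $g$ which locally, in affine coordinates $x_1,\dots,x_d$, is the Hessian of a convex function: $g=\nabla d\phi=\sum_{j,k}\frac{\partial^2\phi}{\partial x_j\partial x_k}dx_j\otimes dx_k$; such a $\phi$ is called a potential of $g$. Then $(X,\nabla,g)$ is called a Hessian manifold. Two Hessian metrics $g,g'$ on $(X,\nabla)$ lie in the same class if $g-g'=\nabla d\phi$ for some smooth function $\phi:X\to\mathbb{R}$. The dual of a Hessian manifold $(X,\nabla,g)$ is the Hessian manifold $(X,\nabla',g)$ with $\nabla'=2\nabla_g-\nabla$, where $\nabla_g$ is the Levi-Civita connection of $g$. Equivalently, on an affine coordinate chart with convex image in $\mathbb{R}^d$ on which $g$ has a potential $\phi$, $\nabla'$ is the pullback of the standard affine structure on $(\mathbb{R}^d)^*$ by the gradient map of $\phi$ in the affine coordinates. *)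

theory Defs
  imports "HOL-Analysis.Analysis"
begin

section \<open>Smooth functions between Euclidean spaces\<close>

primrec Ck_on :: "nat \<Rightarrow> 'a set \<Rightarrow> ('a::real_normed_vector \<Rightarrow> 'b::real_normed_vector) \<Rightarrow> bool"
  where
  "Ck_on 0 S f \<longleftrightarrow> continuous_on S f"
| "Ck_on (Suc k) S f \<longleftrightarrow> (\<forall>x\<in>S. f differentiable (at x)) \<and>
     (\<forall>v. Ck_on k S (\<lambda>x. frechet_derivative f (at x) v))"

text \<open>Only used for open \<open>S\<close>, where the two-sided derivatives do not depend on the values of
  \<open>f\<close> outside \<open>S\<close>.\<close>

definition smooth_on :: "'a set \<Rightarrow> ('a::real_normed_vector \<Rightarrow> 'b::real_normed_vector) \<Rightarrow> bool"
  where "smooth_on S f \<longleftrightarrow> (\<forall>k. Ck_on k S f)"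

definition pd :: "'n \<Rightarrow> (real ^ 'n \<Rightarrow> 'b::real_normed_vector) \<Rightarrow> real ^ 'n \<Rightarrow> 'b"
  where "pd i f y = frechet_derivative f (at y) (axis i 1)"


section \<open>Smooth manifolds\<close>

text \<open>The underlying space of a manifold is a whole Hausdorff, second countable type \<open>'a\<close>; the
  dimension is \<open>CARD('n)\<close>. A chart is a pair of an open domain and a coordinate map, whose values
  outside the domain are irrelevant.\<close>

type_synonym ('a, 'n) chart = "'a set \<times> ('a \<Rightarrow> real ^ 'n)"

definition chart_image :: "('a, 'n) chart \<Rightarrow> (real ^ 'n) set"
  where "chart_image c = snd c ` fst c"

definition chart_inv :: "('a, 'n) chart \<Rightarrow> real ^ 'n \<Rightarrow> 'a"
  where "chart_inv c = inv_into (fst c) (snd c)"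

definition is_chart :: "('a::topological_space, 'n::finite) chart \<Rightarrow> bool"
  where "is_chart c \<longleftrightarrow> open (fst c) \<and> open (chart_image c) \<and>
    homeomorphism (fst c) (chart_image c) (snd c) (chart_inv c)"

text \<open>The coordinate expression of a map \<open>f\<close> and the set of coordinates on which it is meaningful.
  For \<open>f = id\<close> this is the transition map from \<open>c\<close> to \<open>d\<close>.\<close>

definition local_rep :: "('a, 'n) chart \<Rightarrow> ('b, 'm) chart \<Rightarrow> ('a \<Rightarrow> 'b) \<Rightarrow> real ^ 'n \<Rightarrow> real ^ 'm"
  where "local_rep c d f = (\<lambda>y. snd d (f (chart_inv c y)))"

definition local_dom :: "('a, 'n) chart \<Rightarrow> ('b, 'm) chart \<Rightarrow> ('a \<Rightarrow> 'b) \<Rightarrow> (real ^ 'n) set"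
  where "local_dom c d f = snd c ` (fst c \<inter> f -` fst d)"

definition compatible :: "('a, 'n::finite) chart \<Rightarrow> ('a, 'n) chart \<Rightarrow> bool"
  where "compatible c d \<longleftrightarrow> smooth_on (local_dom c d id) (local_rep c d id) \<and>
    smooth_on (local_dom d c id) (local_rep d c id)"

text \<open>A smooth structure is a maximal smooth atlas.\<close>

definition smooth_structure ::
    "('a::{t2_space,second_countable_topology}, 'n::finite) chart set \<Rightarrow> bool"
  where "smooth_structure A \<longleftrightarrow>
    (\<forall>c\<in>A. is_chart c) \<and>
    (\<forall>p. \<exists>c\<in>A. p \<in> fst c) \<and>
    (\<forall>c\<in>A. \<forall>d\<in>A. compatible c d) \<and>
    (\<forall>c. is_chart c \<and> (\<forall>d\<in>A. compatible c d) \<longrightarrow> c \<in> A)"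

definition smooth_map :: "('a::topological_space, 'n::finite) chart set \<Rightarrow>
    ('b::topological_space, 'm::finite) chart set \<Rightarrow> ('a \<Rightarrow> 'b) \<Rightarrow> bool"
  where "smooth_map A B f \<longleftrightarrow> continuous_on UNIV f \<and>
    (\<forall>c\<in>A. \<forall>d\<in>B. smooth_on (local_dom c d f) (local_rep c d f))"

definition diffeo :: "('a::topological_space, 'n::finite) chart set \<Rightarrow>
    ('b::topological_space, 'm::finite) chart set \<Rightarrow> ('a \<Rightarrow> 'b) \<Rightarrow> bool"
  where "diffeo A B f \<longleftrightarrow> bij f \<and> smooth_map A B f \<and> smooth_map B A (inv f)"

definition smooth_function :: "('a, 'n::finite) chart set \<Rightarrow> ('a \<Rightarrow> real) \<Rightarrow> bool"
  where "smooth_function A \<phi> \<longleftrightarrow>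
    (\<forall>c\<in>A. smooth_on (chart_image c) (\<lambda>y. \<phi> (chart_inv c y)))"


section \<open>Connections and affine structures\<close>

text \<open>A connection on the tangent bundle is given by its Christoffel symbols in every chart:
  \<open>\<Gamma> c y $ k $ i $ j\<close> is the coefficient of the \<open>k\<close>-th coordinate vector field in the covariant
  derivative of the \<open>j\<close>-th coordinate field along the \<open>i\<close>-th one, at the point with
  coordinates \<open>y \<in> chart_image c\<close>. Values at other \<open>y\<close> are irrelevant.\<close>

type_synonym ('a, 'n) connection = "('a, 'n) chart \<Rightarrow> real ^ 'n \<Rightarrow> real ^ 'n ^ 'n ^ 'n"

text \<open>A map with coordinate expression \<open>F\<close> carries the connection with symbols \<open>G\<close> at \<open>y\<close> to the
  one with symbols \<open>H\<close> at \<open>F y\<close>.\<close>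

definition christoffel_transform :: "(real ^ 'n::finite \<Rightarrow> real ^ 'n) \<Rightarrow> real ^ 'n \<Rightarrow>
    real ^ 'n ^ 'n ^ 'n \<Rightarrow> real ^ 'n ^ 'n ^ 'n \<Rightarrow> bool"
  where "christoffel_transform F y G H \<longleftrightarrow> (\<forall>i j k.
    (\<Sum>m\<in>UNIV. G $ m $ i $ j * pd m F y $ k) =
      pd i (pd j F) y $ k +
      (\<Sum>a\<in>UNIV. \<Sum>b\<in>UNIV. H $ k $ a $ b * pd i F y $ a * pd j F y $ b))"

definition is_connection :: "('a, 'n::finite) chart set \<Rightarrow> ('a, 'n) connection \<Rightarrow> bool"
  where "is_connection A \<Gamma> \<longleftrightarrow>
    (\<forall>c\<in>A. smooth_on (chart_image c) (\<Gamma> c)) \<and>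
    (\<forall>c\<in>A. \<forall>d\<in>A. \<forall>y\<in>local_dom c d id.
      christoffel_transform (local_rep c d id) y (\<Gamma> c y) (\<Gamma> d (local_rep c d id y)))"

definition torsion_free :: "('a, 'n::finite) chart set \<Rightarrow> ('a, 'n) connection \<Rightarrow> bool"
  where "torsion_free A \<Gamma> \<longleftrightarrow>
    (\<forall>c\<in>A. \<forall>y\<in>chart_image c. \<forall>k i j. \<Gamma> c y $ k $ i $ j = \<Gamma> c y $ k $ j $ i)"

definition curvature :: "('a, 'n::finite) connection \<Rightarrow> ('a, 'n) chart \<Rightarrow> real ^ 'n \<Rightarrow>
    'n \<Rightarrow> 'n \<Rightarrow> 'n \<Rightarrow> 'n \<Rightarrow> real"
  where "curvature \<Gamma> c y l i j k =
    pd i (\<Gamma> c) y $ l $ j $ k - pd j (\<Gamma> c) y $ l $ i $ k +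
    (\<Sum>m\<in>UNIV. \<Gamma> c y $ l $ i $ m * \<Gamma> c y $ m $ j $ k - \<Gamma> c y $ l $ j $ m * \<Gamma> c y $ m $ i $ k)"

definition flat :: "('a, 'n::finite) chart set \<Rightarrow> ('a, 'n) connection \<Rightarrow> bool"
  where "flat A \<Gamma> \<longleftrightarrow> (\<forall>c\<in>A. \<forall>y\<in>chart_image c. \<forall>l i j k. curvature \<Gamma> c y l i j k = 0)"

definition affine_structure :: "('a, 'n::finite) chart set \<Rightarrow> ('a, 'n) connection \<Rightarrow> bool"
  where "affine_structure A \<Gamma> \<longleftrightarrow> is_connection A \<Gamma> \<and> torsion_free A \<Gamma> \<and> flat A \<Gamma>"

text \<open>Affine coordinates are those in which the Christoffel symbols vanish.\<close>

definition affine_chart :: "('a, 'n::finite) chart set \<Rightarrow> ('a, 'n) connection \<Rightarrow>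
    ('a, 'n) chart \<Rightarrow> bool"
  where "affine_chart A \<Gamma> c \<longleftrightarrow> c \<in> A \<and> (\<forall>y\<in>chart_image c. \<Gamma> c y = 0)"

definition affine_isomorphism ::
    "('a::topological_space, 'n::finite) chart set \<Rightarrow> ('a, 'n) connection \<Rightarrow>
     ('b::topological_space, 'n) chart set \<Rightarrow> ('b, 'n) connection \<Rightarrow> ('a \<Rightarrow> 'b) \<Rightarrow> bool"
  where "affine_isomorphism A \<Gamma> B \<Delta> f \<longleftrightarrow> diffeo A B f \<and>
    (\<forall>c\<in>A. \<forall>d\<in>B. \<forall>y\<in>local_dom c d f.
      christoffel_transform (local_rep c d f) y (\<Gamma> c y) (\<Delta> d (local_rep c d f y)))"


section \<open>Hessian metrics\<close>

text \<open>\<open>g c y\<close> is the Gram matrix of the coordinate vector fields of \<open>c\<close> at the point with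
  coordinates \<open>y\<close>.\<close>

type_synonym ('a, 'n) metric = "('a, 'n) chart \<Rightarrow> real ^ 'n \<Rightarrow> real ^ 'n ^ 'n"

definition riemannian_metric :: "('a, 'n::finite) chart set \<Rightarrow> ('a, 'n) metric \<Rightarrow> bool"
  where "riemannian_metric A g \<longleftrightarrow>
    (\<forall>c\<in>A. smooth_on (chart_image c) (g c)) \<and>
    (\<forall>c\<in>A. \<forall>y\<in>chart_image c. transpose (g c y) = g c y \<and>
      (\<forall>v. v \<noteq> 0 \<longrightarrow> v \<bullet> (g c y *v v) > 0)) \<and>
    (\<forall>c\<in>A. \<forall>d\<in>A. \<forall>y\<in>local_dom c d id. \<forall>i j.
      g c y $ i $ j = (\<Sum>a\<in>UNIV. \<Sum>b\<in>UNIV. g d (local_rep c d id y) $ a $ b *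
        pd i (local_rep c d id) y $ a * pd j (local_rep c d id) y $ b))"

definition hessian_metric :: "('a, 'n::finite) chart set \<Rightarrow> ('a, 'n) connection \<Rightarrow>
    ('a, 'n) metric \<Rightarrow> bool"
  where "hessian_metric A \<Gamma> g \<longleftrightarrow> riemannian_metric A g \<and>
    (\<forall>p. \<exists>c. affine_chart A \<Gamma> c \<and> p \<in> fst c \<and> convex (chart_image c) \<and>
      (\<exists>\<phi>. smooth_on (chart_image c) \<phi> \<and> convex_on (chart_image c) \<phi> \<and>
        (\<forall>y\<in>chart_image c. \<forall>j k. g c y $ j $ k = pd j (pd k \<phi>) y)))"

text \<open>The second covariant derivative \<open>\<nabla>d\<phi>\<close> in an arbitrary, not necessarily affine, chart.\<close>

definition cov_hessian :: "('a, 'n::finite) connection \<Rightarrow> ('a \<Rightarrow> real) \<Rightarrow> ('a, 'n) metric"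
  where "cov_hessian \<Gamma> \<phi> c y = (\<chi> i j.
    pd i (pd j (\<lambda>z. \<phi> (chart_inv c z))) y -
    (\<Sum>k\<in>UNIV. \<Gamma> c y $ k $ i $ j * pd k (\<lambda>z. \<phi> (chart_inv c z)) y))"

definition levi_civita :: "('a, 'n::finite) metric \<Rightarrow> ('a, 'n) connection"
  where "levi_civita g c y = (\<chi> k i j. (1 / 2) * (\<Sum>l\<in>UNIV. matrix_inv (g c y) $ k $ l *
    (pd i (g c) y $ j $ l + pd j (g c) y $ i $ l - pd l (g c) y $ i $ j)))"

definition dual_connection :: "('a, 'n::finite) connection \<Rightarrow> ('a, 'n) metric \<Rightarrow>
    ('a, 'n) connection"
  where "dual_connection \<Gamma> g c y = 2 *\<^sub>R levi_civita g c y - \<Gamma> c y"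

end

theory Submission
  imports Defs
begin

text \<open>On an affine chart with convex image let \<open>\<psi>\<close> be a potential of \<open>g\<close>. Every metric
  \<open>g\<^sub>t = (1 - t) g + t g'\<close> of the segment from \<open>g\<close> to \<open>g'\<close> has there the potential \<open>\<psi> - t \<phi>\<close>, and
  the gradient map \<open>F\<^sub>t = d\<psi> - t d\<phi>\<close> carries the dual connection of \<open>g\<^sub>t\<close> to the standard flat one.
  A different affine chart or potential changes all the \<open>F\<^sub>t\<close> by one and the same affine map, so
  the relation \<open>F\<^sub>s y = F\<^sub>t x\<close> between nearby points \<open>x\<close>, \<open>y\<close> makes sense on \<open>X\<close>. Since \<open>F\<^sub>s\<close> is
  injective and \<open>(s, y) \<mapsto> (s, F\<^sub>s y)\<close> is open, it determines \<open>y = f x\<close> uniquely when \<open>s\<close> and \<open>t\<close> are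
  close, uniformly on \<open>X\<close> by compactness, and \<open>f\<close> is an affine isomorphism between the two duals, being the
  identity in the gradient coordinates. This is a discrete form of Moser's trick; the interval
  \<open>[0, 1]\<close> is connected, so the duals of \<open>g = g\<^sub>0\<close> and \<open>g' = g\<^sub>1\<close> are isomorphic.\<close>

section \<open>Calculus of smooth functions\<close>

text \<open>The obstacle is that the identity does not match the two duals: in an affine chart the
  symbols of the dual of \<open>gt t\<close> involve third derivatives of the potential, which
  change with t. The isomorphism has to move points, and it is given only implicitly. Why gradient
  maps flatten: the derivative of a Hessian metric is symmetric in all three indices, so twice its
  Levi-Civita symbol, with lowered index, is the second derivative of \<open>F\<^sub>t\<close>. Why
  one affine map serves all t: potentials of \<open>g\<close> in different charts agree only up to
  an affine function, which adds a constant to the gradient, but \<phi> is a single function on X,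
  so its differential transforms without any constant. Were \<phi> given only up to local affine
  functions, the translations would depend on t and the relation would not glue. Finite steps take
  the place of the flow of a vector field: a step is solved by invariance of domain, and its
  smoothness is read off afterwards from the local formula "inverse of \<open>F\<^sub>s\<close>
  after \<open>F\<^sub>t\<close>".\<close>

lemma Ck_on_cong:
  assumes "open S" "\<And>x. x \<in> S \<Longrightarrow> f x = g x"
  shows "Ck_on k S f \<longleftrightarrow> Ck_on k S g"
  using assms(2)
proof (induction k arbitrary: f g)
  case 0
  then show ?case by (simp cong: continuous_on_cong)
next
  case (Suc k)
  have fd: "frechet_derivative f (at x) = frechet_derivative g (at x)"
    "f differentiable (at x) \<longleftrightarrow> g differentiable (at x)" if "x \<in> S" for x
  proof -
    have *: "(f has_derivative D) (at x) \<longleftrightarrow> (g has_derivative D) (at x)" for D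
      using has_derivative_transform_within_open[OF _ assms(1) that, of f D UNIV g]
        has_derivative_transform_within_open[OF _ assms(1) that, of g D UNIV f] Suc.prems by auto
    show "frechet_derivative f (at x) = frechet_derivative g (at x)"
      "f differentiable (at x) \<longleftrightarrow> g differentiable (at x)"
      by (simp_all add: frechet_derivative_def differentiable_def *)
  qed
  have "Ck_on k S (\<lambda>x. frechet_derivative f (at x) v) \<longleftrightarrow>
      Ck_on k S (\<lambda>x. frechet_derivative g (at x) v)" for v
    by (rule Suc.IH) (simp add: fd)
  then show ?case by (simp add: fd cong: ball_cong)
qed

lemma Ck_on_subset: "Ck_on k S f \<Longrightarrow> T \<subseteq> S \<Longrightarrow> Ck_on k T f"
  by (induction k arbitrary: f) (auto intro: continuous_on_subset)

lemma Ck_on_lower: "Ck_on (Suc k) S f \<Longrightarrow> Ck_on k S f"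
proof (induction k arbitrary: f)
  case 0
  then show ?case
    by (auto intro!: continuous_at_imp_continuous_on differentiable_imp_continuous_within)
next
  case (Suc k)
  have "Ck_on k S (\<lambda>x. frechet_derivative f (at x) v)" for v
    using Suc by (auto simp del: Ck_on.simps(2) simp: Ck_on.simps(2)[of "Suc k"])
  then show ?case using Suc.prems by simp
qed

lemma Ck_on_local:
  assumes "\<And>x. x \<in> S \<Longrightarrow> \<exists>T. open T \<and> x \<in> T \<and> Ck_on k T f"
  shows "Ck_on k S f"
  using assms
proof (induction k arbitrary: f)
  case 0
  then show ?case
    by (auto intro!: continuous_at_imp_continuous_on) (metis continuous_on_eq_continuous_at)
next
  case (Suc k)
  show ?case
    unfolding Ck_on.simps
  proof (intro conjI ballI allI)
    fix x assume "x \<in> S"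
    then show "f differentiable at x" using Suc.prems[of x] by auto
  next
    fix v
    show "Ck_on k S (\<lambda>x. frechet_derivative f (at x) v)"
      by (rule Suc.IH) (use Suc.prems in fastforce)
  qed
qed

text \<open>Any explicit derivative \<open>f'\<close> may be supplied. Most closure rules that
  follow are inductions on \<open>k\<close> through this rule: the derivative is again built from
  functions covered by the induction hypothesis, the undifferentiated factors after weakening by
  \<open>Ck_on_lower\<close>.\<close>

lemma Ck_on_SucI:
  assumes "open S" "\<And>x. x \<in> S \<Longrightarrow> (f has_derivative f' x) (at x)"
    and "\<And>v. Ck_on k S (\<lambda>x. f' x v)"
  shows "Ck_on (Suc k) S f"
proof -
  have "frechet_derivative f (at x) = f' x" if "x \<in> S" for x
    using frechet_derivative_at[OF assms(2)[OF that]] by simp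
  then have "Ck_on k S (\<lambda>x. frechet_derivative f (at x) v)" for v
    using assms(3)[of v] by (subst Ck_on_cong[OF assms(1), where g = "\<lambda>x. f' x v"]) auto
  then show ?thesis using assms(2) by (auto simp: differentiable_def)
qed

lemma Ck_on_SucD:
  assumes "Ck_on (Suc k) S f"
  shows "x \<in> S \<Longrightarrow> (f has_derivative frechet_derivative f (at x)) (at x)"
    and "Ck_on k S (\<lambda>x. frechet_derivative f (at x) v)"
  using assms by (auto simp: frechet_derivative_works)

lemma Ck_on_const: "open S \<Longrightarrow> Ck_on k S (\<lambda>x. c)"
proof (induction k arbitrary: c)
  case (Suc k)
  show ?case by (rule Ck_on_SucI[where f' = "\<lambda>x v. 0"]) (use Suc in auto)
qed simp

lemma Ck_on_bounded_linear:
  assumes "open S" "bounded_linear L" "Ck_on k S f"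
  shows "Ck_on k S (\<lambda>x. L (f x))"
  using assms(3)
proof (induction k arbitrary: f)
  case 0
  then show ?case using assms(2) by (simp add: bounded_linear.continuous_on)
next
  case (Suc k)
  show ?case
    by (rule Ck_on_SucI[where f' = "\<lambda>x v. L (frechet_derivative f (at x) v)"])
      (auto intro!: assms Suc.IH Ck_on_SucD[OF Suc.prems] bounded_linear.has_derivative[OF assms(2)])
qed

lemma Ck_on_add:
  assumes "open S" "Ck_on k S f" "Ck_on k S g"
  shows "Ck_on k S (\<lambda>x. f x + g x)"
  using assms(2,3)
proof (induction k arbitrary: f g)
  case 0
  then show ?case by (simp add: continuous_on_add)
next
  case (Suc k)
  show ?case
    by (rule Ck_on_SucI[where f' = "\<lambda>x v. frechet_derivative f (at x) v + frechet_derivative g (at x) v"])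
      (use assms Suc Ck_on_SucD[OF Suc.prems(1)] Ck_on_SucD[OF Suc.prems(2)]
       in \<open>auto intro!: has_derivative_add\<close>)
qed

lemma Ck_on_sum:
  assumes "open S" "\<And>i. i \<in> I \<Longrightarrow> Ck_on k S (f i)"
  shows "Ck_on k S (\<lambda>x. \<Sum>i\<in>I. f i x)"
  using assms(2)
  by (induction I rule: infinite_finite_induct) (auto intro!: Ck_on_const Ck_on_add assms(1))

lemma Ck_on_bilinear:
  assumes "open S" "bounded_bilinear B" "Ck_on k S f" "Ck_on k S g"
  shows "Ck_on k S (\<lambda>x. B (f x) (g x))"
  using assms(3,4)
proof (induction k arbitrary: f g)
  case 0
  then show ?case using assms(2) by (simp add: bounded_bilinear.continuous_on)
next
  case (Suc k)
  show ?case
  proof (rule Ck_on_SucI[where f' = "\<lambda>x v. B (f x) (frechet_derivative g (at x) v) + B (frechet_derivative f (at x) v) (g x)"])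
    fix v
    show "Ck_on k S (\<lambda>x. B (f x) (frechet_derivative g (at x) v) + B (frechet_derivative f (at x) v) (g x))"
      by (intro Ck_on_add Suc.IH assms(1) Ck_on_SucD(2)[OF Suc.prems(1)] Ck_on_SucD(2)[OF Suc.prems(2)]
           Ck_on_lower[OF Suc.prems(1)] Ck_on_lower[OF Suc.prems(2)])
  qed (rule assms bounded_bilinear.FDERIV[OF assms(2)]
      Ck_on_SucD(1)[OF Suc.prems(1)] Ck_on_SucD(1)[OF Suc.prems(2)] | assumption)+
qed

lemma Ck_on_compose:
  fixes g :: "'a::real_normed_vector \<Rightarrow> 'b::euclidean_space" and f :: "'b \<Rightarrow> 'c::real_normed_vector"
  assumes "open S" "open T" "Ck_on k T f" "Ck_on k S g" "g ` S \<subseteq> T"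
  shows "Ck_on k S (\<lambda>x. f (g x))"
  using assms(3,4)
proof (induction k arbitrary: f)
  case 0
  then show ?case using assms(5) continuous_on_compose2 by auto
next
  case (Suc k)
  \<comment> \<open>\<open>Ck_on\<close> controls the derivative of \<open>f\<close> only in fixed
    directions, whereas the derivative of \<open>g\<close> is a direction that moves with
    \<open>x\<close>. Expanding it in \<open>Basis\<close> leaves fixed directions \<open>b\<close>
    with scalar coefficients; the middle space is Euclidean for this reason.\<close>
  let ?D = "\<lambda>x v. \<Sum>b\<in>Basis. (frechet_derivative g (at x) v \<bullet> b) *\<^sub>R frechet_derivative f (at (g x)) b"
  show ?case
  proof (rule Ck_on_SucI[where f' = ?D])
    fix x assume x: "x \<in> S"
    have f': "(f has_derivative frechet_derivative f (at (g x))) (at (g x))"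
      using Suc.prems(1) x assms(5) Ck_on_SucD(1) by blast
    have "((\<lambda>x. f (g x)) has_derivative (\<lambda>v. frechet_derivative f (at (g x)) (frechet_derivative g (at x) v))) (at x)"
      using has_derivative_compose[OF Ck_on_SucD(1)[OF Suc.prems(2) x] f'] .
    moreover have "frechet_derivative f (at (g x)) (frechet_derivative g (at x) v) = ?D x v" for v
    proof -
      interpret linear "frechet_derivative f (at (g x))"
        using f' by (rule has_derivative_linear)
      show ?thesis
        by (subst euclidean_representation[of "frechet_derivative g (at x) v", symmetric])
           (simp only: sum scaleR)
    qed
    ultimately show "((\<lambda>x. f (g x)) has_derivative ?D x) (at x)" by simp
  next
    fix v
    show "Ck_on k S (\<lambda>x. ?D x v)"
      by (intro Ck_on_sum Ck_on_bilinear[OF _ bounded_bilinear_scaleR] assms(1) Suc.IH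
          Ck_on_bounded_linear[OF _ bounded_linear_inner_left]
          Ck_on_SucD(2)[OF Suc.prems(1)] Ck_on_SucD(2)[OF Suc.prems(2)] Ck_on_lower[OF Suc.prems(2)])
  qed (rule assms(1))
qed

lemma Ck_on_vec:
  fixes f :: "'a::real_normed_vector \<Rightarrow> 'b::euclidean_space ^ 'n"
  assumes "open S" "\<And>i. Ck_on k S (\<lambda>x. f x $ i)"
  shows "Ck_on k S f"
proof -
  have eq: "f x = (\<Sum>i\<in>UNIV. axis i (f x $ i))" for x
    by (simp add: vec_eq_iff axis_def if_distrib[of "\<lambda>u. u $ _"] sum.delta cong: if_cong)
  have "linear (axis i :: 'b \<Rightarrow> 'b ^ 'n)" for i
    by (rule linearI) (auto simp: vec_eq_iff axis_def)
  then have "bounded_linear (axis i :: 'b \<Rightarrow> 'b ^ 'n)" for i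
    by (simp add: linear_conv_bounded_linear)
  then have "Ck_on k S (\<lambda>x. axis i (f x $ i) :: 'b ^ 'n)" for i
    by (rule Ck_on_bounded_linear[OF assms(1) _ assms(2)])
  then have "Ck_on k S (\<lambda>x. \<Sum>i\<in>UNIV. axis i (f x $ i))"
    by (rule Ck_on_sum[OF assms(1)])
  then show ?thesis by (simp only: eq[symmetric])
qed

lemma Ck_on_inverse:
  fixes f :: "'a::real_normed_vector \<Rightarrow> real"
  assumes "open S" "Ck_on k S f" "\<And>x. x \<in> S \<Longrightarrow> f x \<noteq> 0"
  shows "Ck_on k S (\<lambda>x. inverse (f x))"
  using assms(2)
proof (induction k)
  case 0
  then show ?case using assms by (simp add: continuous_on_inverse)
next
  case (Suc k)
  show ?case
  proof (rule Ck_on_SucI[where f' = "\<lambda>x v. - (inverse (f x) * frechet_derivative f (at x) v * inverse (f x))"])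
    fix v
    show "Ck_on k S (\<lambda>x. - (inverse (f x) * frechet_derivative f (at x) v * inverse (f x)))"
      by (intro Ck_on_bounded_linear[OF _ bounded_linear_minus[OF bounded_linear_ident]]
          Ck_on_bilinear[OF _ bounded_bilinear_mult] Suc Ck_on_SucD[OF Suc.prems]
          Ck_on_lower[OF Suc.prems] assms)
  qed (use assms Ck_on_SucD[OF Suc.prems] in \<open>auto intro!: Deriv.has_derivative_inverse\<close>)
qed

section \<open>The same rules for smooth functions\<close>

lemma smooth_on_cong: "open S \<Longrightarrow> (\<And>x. x \<in> S \<Longrightarrow> f x = g x) \<Longrightarrow> smooth_on S f \<longleftrightarrow> smooth_on S g"
  unfolding smooth_on_def using Ck_on_cong by metis

lemma smooth_on_subset: "smooth_on S f \<Longrightarrow> T \<subseteq> S \<Longrightarrow> smooth_on T f"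
  unfolding smooth_on_def using Ck_on_subset by blast

lemma smooth_on_local:
  "(\<And>x. x \<in> S \<Longrightarrow> \<exists>T. open T \<and> x \<in> T \<and> smooth_on T f) \<Longrightarrow> smooth_on S f"
  unfolding smooth_on_def using Ck_on_local by metis

lemma smooth_on_const: "open S \<Longrightarrow> smooth_on S (\<lambda>x. c)"
  by (simp add: smooth_on_def Ck_on_const)

lemma smooth_on_bounded_linear:
  "open S \<Longrightarrow> bounded_linear L \<Longrightarrow> smooth_on S f \<Longrightarrow> smooth_on S (\<lambda>x. L (f x))"
  by (simp add: smooth_on_def Ck_on_bounded_linear)

lemma smooth_on_add:
  "open S \<Longrightarrow> smooth_on S f \<Longrightarrow> smooth_on S g \<Longrightarrow> smooth_on S (\<lambda>x. f x + g x)"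
  by (simp add: smooth_on_def Ck_on_add)

lemma smooth_on_sum:
  "open S \<Longrightarrow> (\<And>i. i \<in> I \<Longrightarrow> smooth_on S (f i)) \<Longrightarrow> smooth_on S (\<lambda>x. \<Sum>i\<in>I. f i x)"
  by (simp add: smooth_on_def Ck_on_sum)

lemma smooth_on_bilinear:
  "open S \<Longrightarrow> bounded_bilinear B \<Longrightarrow> smooth_on S f \<Longrightarrow> smooth_on S g \<Longrightarrow>
    smooth_on S (\<lambda>x. B (f x) (g x))"
  by (simp add: smooth_on_def Ck_on_bilinear)

lemma smooth_on_scaleR:
  "open S \<Longrightarrow> smooth_on S f \<Longrightarrow> smooth_on S (\<lambda>x. c *\<^sub>R f x)"
  by (rule smooth_on_bounded_linear[OF _ bounded_linear_scaleR_right])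

lemma smooth_on_diff:
  assumes "open S" "smooth_on S f" "smooth_on S g"
  shows "smooth_on S (\<lambda>x. f x - g x)"
  using smooth_on_add[OF assms(1,2) smooth_on_scaleR[OF assms(1,3), of "- 1"]] by simp

lemma smooth_on_mult:
  fixes f g :: "'a::real_normed_vector \<Rightarrow> real"
  shows "open S \<Longrightarrow> smooth_on S f \<Longrightarrow> smooth_on S g \<Longrightarrow> smooth_on S (\<lambda>x. f x * g x)"
  by (rule smooth_on_bilinear[OF _ bounded_bilinear_mult])

lemma smooth_on_prod:
  fixes f :: "'i \<Rightarrow> 'a::real_normed_vector \<Rightarrow> real"
  assumes "open S" "\<And>i. i \<in> I \<Longrightarrow> smooth_on S (f i)"
  shows "smooth_on S (\<lambda>x. \<Prod>i\<in>I. f i x)"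
  using assms(2)
  by (induction I rule: infinite_finite_induct) (auto intro!: smooth_on_const smooth_on_mult assms(1))

lemma smooth_on_inverse:
  fixes f :: "'a::real_normed_vector \<Rightarrow> real"
  shows "open S \<Longrightarrow> smooth_on S f \<Longrightarrow> (\<And>x. x \<in> S \<Longrightarrow> f x \<noteq> 0) \<Longrightarrow> smooth_on S (\<lambda>x. inverse (f x))"
  by (simp add: smooth_on_def Ck_on_inverse)

lemma smooth_on_compose:
  fixes g :: "'a::real_normed_vector \<Rightarrow> 'b::euclidean_space"
  shows "open S \<Longrightarrow> open T \<Longrightarrow> smooth_on T f \<Longrightarrow> smooth_on S g \<Longrightarrow> g ` S \<subseteq> T \<Longrightarrow>
    smooth_on S (\<lambda>x. f (g x))"
  unfolding smooth_on_def using Ck_on_compose by blast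

lemma smooth_on_vec:
  fixes f :: "'a::real_normed_vector \<Rightarrow> 'b::euclidean_space ^ 'n"
  shows "open S \<Longrightarrow> (\<And>i. smooth_on S (\<lambda>x. f x $ i)) \<Longrightarrow> smooth_on S f"
  by (simp add: smooth_on_def Ck_on_vec)

lemma smooth_on_nth: "open S \<Longrightarrow> smooth_on S f \<Longrightarrow> smooth_on S (\<lambda>x. f x $ i)"
  by (rule smooth_on_bounded_linear[OF _ bounded_linear_vec_nth])

lemma smooth_on_differentiable: "smooth_on S f \<Longrightarrow> x \<in> S \<Longrightarrow> f differentiable (at x)"
  unfolding smooth_on_def by (metis Ck_on.simps(2))

lemma smooth_on_continuous_on: "smooth_on S f \<Longrightarrow> continuous_on S f"
  unfolding smooth_on_def by (metis Ck_on.simps(1))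

lemma smooth_on_pd: "smooth_on S f \<Longrightarrow> smooth_on S (pd i f)"
  unfolding smooth_on_def pd_def[abs_def] by (metis Ck_on.simps(2))

section \<open>Rules for partial derivatives\<close>

lemma frechet_derivative_worksI:
  "f differentiable (at y) \<Longrightarrow> (f has_derivative frechet_derivative f (at y)) (at y)"
  by (simp add: frechet_derivative_works)

lemma has_derivative_pd:
  fixes f :: "real ^ 'n \<Rightarrow> 'b::real_normed_vector"
  assumes "f differentiable (at y)"
  shows "(f has_derivative (\<lambda>v. \<Sum>i\<in>UNIV. (v $ i) *\<^sub>R pd i f y)) (at y)"
proof -
  have d: "(f has_derivative frechet_derivative f (at y)) (at y)"
    by (rule frechet_derivative_worksI[OF assms])
  interpret linear "frechet_derivative f (at y)"
    using d by (rule has_derivative_linear)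
  have "frechet_derivative f (at y) v = (\<Sum>i\<in>UNIV. (v $ i) *\<^sub>R pd i f y)" for v
    by (subst basis_expansion[of v, symmetric])
      (simp only: sum scaleR pd_def vector_scalar_mult_def scalar_mult_eq_scaleR)
  then have "frechet_derivative f (at y) = (\<lambda>v. \<Sum>i\<in>UNIV. (v $ i) *\<^sub>R pd i f y)"
    by (rule ext)
  then show ?thesis using d by (simp only:)
qed

lemma pd_eqI:
  assumes "(f has_derivative D) (at y)"
  shows "pd i f y = D (axis i 1)"
  using frechet_derivative_at[OF assms] by (simp add: pd_def)

lemma pd_cong:
  assumes "open S" "y \<in> S" "\<And>x. x \<in> S \<Longrightarrow> f x = g x" "g differentiable (at y)"
  shows "pd i f y = pd i g y"
proof -
  have "(g has_derivative frechet_derivative g (at y)) (at y)"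
    by (rule frechet_derivative_worksI[OF assms(4)])
  then have "(f has_derivative frechet_derivative g (at y)) (at y)"
    by (rule has_derivative_transform_within_open[OF _ assms(1,2)]) (simp add: assms(3))
  from pd_eqI[OF this] show ?thesis by (simp add: pd_def)
qed

lemma pd_nth:
  assumes "f differentiable (at y)"
  shows "pd i (\<lambda>z. f z $ k) y = pd i f y $ k"
  using pd_eqI[OF bounded_linear.has_derivative[OF bounded_linear_vec_nth
    frechet_derivative_worksI[OF assms]]] by (simp add: pd_def)

lemma pd_compose:
  fixes F :: "real ^ 'n \<Rightarrow> real ^ 'm" and G :: "real ^ 'm \<Rightarrow> 'b::real_normed_vector"
  assumes "F differentiable (at y)" "G differentiable (at (F y))"
  shows "pd j (\<lambda>z. G (F z)) y = (\<Sum>b\<in>UNIV. (pd j F y $ b) *\<^sub>R pd b G (F y))"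
proof -
  have "(F has_derivative frechet_derivative F (at y)) (at y)"
    by (rule frechet_derivative_worksI[OF assms(1)])
  from pd_eqI[OF has_derivative_compose[OF this has_derivative_pd[OF assms(2)]]]
  show ?thesis by (simp add: pd_def)
qed

lemma pd_diff:
  "f differentiable (at y) \<Longrightarrow> g differentiable (at y) \<Longrightarrow> pd i (\<lambda>z. f z - g z) y = pd i f y - pd i g y"
  using pd_eqI[OF has_derivative_diff[OF frechet_derivative_worksI frechet_derivative_worksI]]
  by (simp add: pd_def)

lemma pd_scaleR:
  assumes "f differentiable (at y)"
  shows "pd i (\<lambda>z. c *\<^sub>R f z) y = c *\<^sub>R pd i f y"
  using pd_eqI[OF has_derivative_scaleR_right[OF frechet_derivative_worksI[OF assms]]]
  by (simp add: pd_def)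

lemma pd_mult:
  fixes f g :: "real ^ 'n \<Rightarrow> real"
  assumes "f differentiable (at y)" "g differentiable (at y)"
  shows "pd i (\<lambda>z. f z * g z) y = pd i f y * g y + f y * pd i g y"
  using pd_eqI[OF has_derivative_mult[OF assms[THEN frechet_derivative_worksI]]]
  by (simp add: pd_def)

lemma pd_sum:
  assumes "finite I" "\<And>a. a \<in> I \<Longrightarrow> f a differentiable (at y)"
  shows "pd i (\<lambda>z. \<Sum>a\<in>I. f a z) y = (\<Sum>a\<in>I. pd i (f a) y)"
proof -
  have "((\<lambda>z. \<Sum>a\<in>I. f a z) has_derivative (\<lambda>v. \<Sum>a\<in>I. frechet_derivative (f a) (at y) v)) (at y)"
    by (intro has_derivative_sum frechet_derivative_worksI assms)
  from pd_eqI[OF this] show ?thesis by (simp add: pd_def)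
qed

section \<open>Symmetry of second derivatives and inverse functions\<close>

lemma DERIV_along_axis:
  fixes f :: "real ^ 'n \<Rightarrow> real"
  assumes "f differentiable (at (p + a *\<^sub>R axis i 1))"
  shows "((\<lambda>a. f (p + a *\<^sub>R axis i 1)) has_real_derivative pd i f (p + a *\<^sub>R axis i 1)) (at a)"
proof -
  let ?D = "frechet_derivative f (at (p + a *\<^sub>R axis i 1))"
  have f: "(f has_derivative ?D) (at (p + a *\<^sub>R axis i 1))"
    by (rule frechet_derivative_worksI[OF assms])
  have "((\<lambda>a. p + a *\<^sub>R axis i 1) has_derivative (\<lambda>h. h *\<^sub>R axis i 1)) (at a)"
    by (auto intro!: derivative_eq_intros)
  from has_derivative_compose[OF this f]
  have "((\<lambda>a. f (p + a *\<^sub>R axis i 1)) has_derivative (\<lambda>h. ?D (h *\<^sub>R axis i 1))) (at a)" .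
  moreover have "?D (h *\<^sub>R axis i 1) = pd i f (p + a *\<^sub>R axis i 1) * h" for h
    using linear_scale[OF has_derivative_linear[OF f]] by (simp add: pd_def)
  ultimately show ?thesis by (simp add: has_field_derivative_def)
qed

text \<open>The mean value theorem is applied twice: along axis \<open>i\<close> to the difference
  of \<open>f\<close> between two opposite sides of the square, then along axis \<open>j\<close>.
  The second difference is symmetric in \<open>i\<close> and \<open>j\<close>, which is what forces
  the mixed partials to agree.\<close>

lemma second_difference_mvt:
  fixes f :: "real ^ 'n \<Rightarrow> real"
  assumes "0 < h" "smooth_on S f"
    and S: "\<And>a b. 0 \<le> a \<Longrightarrow> a \<le> h \<Longrightarrow> 0 \<le> b \<Longrightarrow> b \<le> h \<Longrightarrow> x + a *\<^sub>R axis i 1 + b *\<^sub>R axis j 1 \<in> S"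
  obtains a b where "0 < a" "a < h" "0 < b" "b < h"
    "f (x + h *\<^sub>R axis i 1 + h *\<^sub>R axis j 1) - f (x + h *\<^sub>R axis i 1) - f (x + h *\<^sub>R axis j 1) + f x
      = h * h * pd j (pd i f) (x + a *\<^sub>R axis i 1 + b *\<^sub>R axis j 1)"
proof -
  let ?u = "\<lambda>a b. x + a *\<^sub>R axis i 1 + b *\<^sub>R axis j 1"
  define \<phi> where "\<phi> a = f (?u a h) - f (?u a 0)" for a
  have "(\<phi> has_real_derivative pd i f (?u a h) - pd i f (?u a 0)) (at a)" if "0 \<le> a" "a \<le> h" for a
  proof -
    have "f differentiable at (?u a h)" "f differentiable at (?u a 0)"
      using S[of a h] S[of a 0] that assms by (auto intro: smooth_on_differentiable)
    then show ?thesis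
      unfolding \<phi>_def
      using DERIV_along_axis[of f "x + h *\<^sub>R axis j 1" a i] DERIV_along_axis[of f "x" a i]
      by (auto simp: add_ac intro!: DERIV_diff)
  qed
  from MVT2[OF assms(1) this] obtain a where a: "0 < a" "a < h"
    "\<phi> h - \<phi> 0 = h * (pd i f (?u a h) - pd i f (?u a 0))" by auto
  have "((\<lambda>b. pd i f (?u a b)) has_real_derivative pd j (pd i f) (?u a b)) (at b)"
    if "0 \<le> b" "b \<le> h" for b
    by (rule DERIV_along_axis, rule smooth_on_differentiable[OF smooth_on_pd[OF assms(2)]])
      (use S[of a b] that a in auto)
  from MVT2[OF assms(1) this] obtain b where b: "0 < b" "b < h"
    "pd i f (?u a h) - pd i f (?u a 0) = h * pd j (pd i f) (?u a b)" by auto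
  show ?thesis
    by (rule that[OF a(1,2) b(1,2)]) (use a(3) b(3) in \<open>simp add: \<phi>_def\<close>)
qed

lemma pd_commute_real:
  fixes f :: "real ^ 'n \<Rightarrow> real"
  assumes "open S" "x \<in> S" "smooth_on S f"
  shows "pd i (pd j f) x = pd j (pd i f) x"
proof (rule ccontr)
  assume ne: "pd i (pd j f) x \<noteq> pd j (pd i f) x"
  define e where "e = \<bar>pd i (pd j f) x - pd j (pd i f) x\<bar> / 2"
  have e: "e > 0" using ne by (simp add: e_def)
  have c: "isCont (pd k (pd l f)) x" for k l
    using smooth_on_continuous_on[OF smooth_on_pd[OF smooth_on_pd[OF assms(3)]]] assms(1,2)
    by (simp add: continuous_on_eq_continuous_at)
  obtain d1 where d1: "d1 > 0" "\<And>y. dist y x < d1 \<Longrightarrow> dist (pd i (pd j f) y) (pd i (pd j f) x) < e"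
    using c[of i j] e unfolding continuous_at_eps_delta by blast
  obtain d2 where d2: "d2 > 0" "\<And>y. dist y x < d2 \<Longrightarrow> dist (pd j (pd i f) y) (pd j (pd i f) x) < e"
    using c[of j i] e unfolding continuous_at_eps_delta by blast
  obtain d3 where d3: "d3 > 0" "ball x d3 \<subseteq> S" using assms(1,2) open_contains_ball by blast
  define d where "d = min d1 (min d2 d3)"
  have d: "d > 0" "d \<le> d1" "d \<le> d2" "d \<le> d3" using d1(1) d2(1) d3(1) by (auto simp: d_def)
  \<comment> \<open>A third of \<open>d\<close>, so that two displacements of length at most
    \<open>h\<close> together stay below \<open>d\<close>.\<close>
  define h where "h = d / 3"
  have h: "h > 0" using d by (simp add: h_def)
  have near: "dist (x + a *\<^sub>R axis k 1 + b *\<^sub>R axis l 1) x < d"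
    if "0 \<le> a" "a \<le> h" "0 \<le> b" "b \<le> h" for a b and k l :: 'n
  proof -
    have "dist (x + a *\<^sub>R axis k 1 + b *\<^sub>R axis l 1) x = norm (a *\<^sub>R axis k 1 + b *\<^sub>R axis l (1::real))"
      by (simp add: dist_norm add.assoc)
    also have "\<dots> \<le> a + b"
      using norm_triangle_ineq[of "a *\<^sub>R axis k 1" "b *\<^sub>R axis l (1::real)"] that by simp
    also have "\<dots> < d" using that d by (simp add: h_def)
    finally show ?thesis .
  qed
  have S: "x + a *\<^sub>R axis k 1 + b *\<^sub>R axis l 1 \<in> S"
    if "0 \<le> a" "a \<le> h" "0 \<le> b" "b \<le> h" for a b and k l :: 'n
    using near[OF that, of k l] d d3 by (auto simp: dist_commute subset_iff)
  obtain a b where ab: "0 < a" "a < h" "0 < b" "b < h"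
    "f (x + h *\<^sub>R axis i 1 + h *\<^sub>R axis j 1) - f (x + h *\<^sub>R axis i 1) - f (x + h *\<^sub>R axis j 1) + f x
      = h * h * pd j (pd i f) (x + a *\<^sub>R axis i 1 + b *\<^sub>R axis j 1)"
    by (rule second_difference_mvt[OF h assms(3), of x i j]; blast intro: S)
  obtain a' b' where ab': "0 < a'" "a' < h" "0 < b'" "b' < h"
    "f (x + h *\<^sub>R axis j 1 + h *\<^sub>R axis i 1) - f (x + h *\<^sub>R axis j 1) - f (x + h *\<^sub>R axis i 1) + f x
      = h * h * pd i (pd j f) (x + a' *\<^sub>R axis j 1 + b' *\<^sub>R axis i 1)"
    by (rule second_difference_mvt[OF h assms(3), of x j i]; blast intro: S)
  have "h * h * pd j (pd i f) (x + a *\<^sub>R axis i 1 + b *\<^sub>R axis j 1)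
    = h * h * pd i (pd j f) (x + a' *\<^sub>R axis j 1 + b' *\<^sub>R axis i 1)"
    unfolding ab(5)[symmetric] ab'(5)[symmetric] by (simp add: add_ac)
  then have eq: "pd j (pd i f) (x + a *\<^sub>R axis i 1 + b *\<^sub>R axis j 1)
    = pd i (pd j f) (x + a' *\<^sub>R axis j 1 + b' *\<^sub>R axis i 1)"
    using h by simp
  have "dist (pd j (pd i f) (x + a *\<^sub>R axis i 1 + b *\<^sub>R axis j 1)) (pd j (pd i f) x) < e"
    by (rule d2(2), rule less_le_trans[OF near d(3)]) (use ab in auto)
  moreover have "dist (pd i (pd j f) (x + a' *\<^sub>R axis j 1 + b' *\<^sub>R axis i 1)) (pd i (pd j f) x) < e"
    by (rule d1(2), rule less_le_trans[OF near d(2)]) (use ab' in auto)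
  \<comment> \<open>By \<open>eq\<close> one and the same number would lie within \<open>e\<close>,
    half of the gap, of both mixed partials.\<close>
  moreover have "\<not> (dist v b < dist a b / 2 \<and> dist v a < dist a b / 2)" for a b v :: real
    using dist_triangle2[of a b v] by (simp add: dist_commute)
  ultimately show False using eq by (metis e_def dist_real_def)
qed

lemma pd_pd_nth:
  assumes "open S" "y \<in> S" "smooth_on S f"
  shows "pd i (pd j f) y $ k = pd i (pd j (\<lambda>z. f z $ k)) y"
proof -
  have "pd i (pd j (\<lambda>z. f z $ k)) y = pd i (\<lambda>z. pd j f z $ k) y"
    using assms smooth_on_differentiable[OF assms(3)]
      smooth_on_differentiable[OF smooth_on_nth[OF assms(1) smooth_on_pd[OF assms(3)]]]
    by (intro pd_cong[OF assms(1,2)]) (auto intro: pd_nth)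
  then show ?thesis
    using pd_nth[OF smooth_on_differentiable[OF smooth_on_pd[OF assms(3)] assms(2)]] by simp
qed

lemma pd_commute:
  fixes f :: "real ^ 'n \<Rightarrow> real ^ 'm"
  assumes "open S" "x \<in> S" "smooth_on S f"
  shows "pd i (pd j f) x = pd j (pd i f) x"
  by (simp add: vec_eq_iff pd_pd_nth[OF assms] pd_commute_real[OF assms(1,2) smooth_on_nth[OF assms(1,3)]])

lemma smooth_on_det:
  fixes M :: "'a::real_normed_vector \<Rightarrow> real ^ 'n ^ 'n"
  assumes "open S" "\<And>i j. smooth_on S (\<lambda>y. M y $ i $ j)"
  shows "smooth_on S (\<lambda>y. det (M y))"
  unfolding det_def
  by (intro smooth_on_sum smooth_on_mult smooth_on_prod smooth_on_const assms)

text \<open>Openness is invariance of domain. For smoothness, Cramer's rule writes the solution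
  \<open>J v y\<close> of the linearised equation as a quotient of determinants, hence smoothly in
  \<open>y\<close>. The derivative of \<open>G\<close> is \<open>J v (G z)\<close>, so each degree
  of regularity of \<open>G\<close> yields the next.\<close>

lemma smooth_on_inverse_function:
  fixes F G :: "real ^ 'n \<Rightarrow> real ^ 'n"
  assumes S: "open S" and F: "smooth_on S F" and G: "\<And>y. y \<in> S \<Longrightarrow> G (F y) = y"
    and inv: "\<And>y v. y \<in> S \<Longrightarrow> (\<Sum>i\<in>UNIV. (v $ i) *\<^sub>R pd i F y) = 0 \<Longrightarrow> v = 0"
  shows "open (F ` S)" "smooth_on (F ` S) G"
proof -
  have inj: "inj_on F S" using G by (metis inj_onI)
  show o: "open (F ` S)"
    by (rule invariance_of_domain[OF smooth_on_continuous_on[OF F] S inj])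
  define M :: "real ^ 'n \<Rightarrow> real ^ 'n ^ 'n" where "M y = (\<chi> k i. pd i F y $ k)" for y
  define J where "J v y = (\<chi> k. det (\<chi> i j. if j = k then v $ i else M y $ i $ j) / det (M y))"
    for v y
  have Mv: "M y *v v = (\<Sum>i\<in>UNIV. (v $ i) *\<^sub>R pd i F y)" for y v
    by (simp add: vec_eq_iff matrix_vector_mult_def M_def mult.commute)
  have "det (M y) \<noteq> 0" if "y \<in> S" for y
    using inv[OF that] matrix_left_invertible_ker[of "M y"]
    by (auto simp: Mv invertible_det_nz[symmetric] invertible_left_inverse)
  note det = this
  have sM: "smooth_on S (\<lambda>y. M y $ i $ j)" for i j
    by (simp add: M_def smooth_on_nth[OF S] smooth_on_pd[OF F])
  have sJ: "smooth_on S (J v)" for v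
  proof (rule smooth_on_vec[OF S])
    fix k
    have "smooth_on S (\<lambda>y. (\<chi> i j. if j = k then v $ i else M y $ i $ j) $ i $ j)" for i j
      by (cases "j = k") (auto simp: sM smooth_on_const[OF S])
    then have "smooth_on S (\<lambda>y. det (\<chi> i j. if j = k then v $ i else M y $ i $ j) * inverse (det (M y)))"
      by (intro smooth_on_mult smooth_on_inverse smooth_on_det S sM det)
    then show "smooth_on S (\<lambda>y. J v y $ k)"
      by (simp add: J_def divide_inverse)
  qed
  have MJ: "M y *v J v y = v" if "y \<in> S" for y v
    using cramer[OF det[OF that]] by (simp add: J_def)
  have G': "(G has_derivative (\<lambda>v. J v (G z))) (at z)" if "z \<in> F ` S" for z
  proof -
    obtain y where y: "y \<in> S" "z = F y" using \<open>z \<in> F ` S\<close> by blast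
    have "(G has_derivative (\<lambda>v. J v y)) (at (F y))"
    proof (rule has_derivative_inverse_on[where f' = "\<lambda>y v. M y *v v" and g' = "\<lambda>y v. J v y" and x = y, OF S])
      fix x assume "x \<in> S"
      then show "(F has_derivative (\<lambda>v. M x *v v)) (at x)"
        using has_derivative_pd[OF smooth_on_differentiable[OF F]] by (simp add: Mv)
    qed (auto simp: fun_eq_iff MJ G y)
    then show ?thesis by (simp add: y G)
  qed
  have "Ck_on k (F ` S) G" for k
  proof (induction k)
    case 0
    show ?case
      by (auto intro!: continuous_at_imp_continuous_on has_derivative_continuous[OF G'])
  next
    case (Suc k)
    show ?case
    proof (rule Ck_on_SucI[OF o G'])
      fix v
      have "Ck_on k S (J v)" using sJ by (simp add: smooth_on_def)
      then show "Ck_on k (F ` S) (\<lambda>z. J v (G z))"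
        by (rule Ck_on_compose[OF o S _ Suc]) (auto simp: G)
    qed
  qed
  then show "smooth_on (F ` S) G" by (simp add: smooth_on_def)
qed

text \<open>Strict monotonicity: along the segment from \<open>x\<close> to \<open>y\<close> the
  inner product of \<open>F\<close> with \<open>y - x\<close> has positive derivative, so its values
  at the two ends differ.\<close>

lemma inj_on_positive_derivative:
  fixes F :: "real ^ 'n \<Rightarrow> real ^ 'n"
  assumes "convex S" "\<And>y. y \<in> S \<Longrightarrow> F differentiable (at y)"
    and pos: "\<And>y v. y \<in> S \<Longrightarrow> v \<noteq> 0 \<Longrightarrow> v \<bullet> (\<Sum>i\<in>UNIV. (v $ i) *\<^sub>R pd i F y) > 0"
  shows "inj_on F S"
proof (rule inj_onI, rule ccontr)
  fix x y assume xy: "x \<in> S" "y \<in> S" "F x = F y" "x \<noteq> y"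
  define p where "p u = x + u *\<^sub>R (y - x)" for u
  have p: "p u \<in> S" if "0 \<le> u" "u \<le> 1" for u
  proof -
    have "p u = (1 - u) *\<^sub>R x + u *\<^sub>R y" by (simp add: p_def algebra_simps)
    then show ?thesis using convexD[OF assms(1) xy(1,2), of "1 - u" u] that by simp
  qed
  let ?D = "\<lambda>u v. \<Sum>i\<in>UNIV. (v $ i) *\<^sub>R pd i F (p u)"
  have "((\<lambda>u. F (p u) \<bullet> (y - x)) has_real_derivative ?D u (y - x) \<bullet> (y - x)) (at u)"
    if "0 \<le> u" "u \<le> 1" for u
  proof -
    have dF: "(F has_derivative ?D u) (at (p u))"
      using has_derivative_pd[OF assms(2)[OF p[OF that]]] .
    have "(p has_derivative (\<lambda>h. h *\<^sub>R (y - x))) (at u)"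
      unfolding p_def by (auto intro!: derivative_eq_intros)
    from has_derivative_compose[OF this dF]
    have "((\<lambda>u. F (p u) \<bullet> (y - x)) has_derivative (\<lambda>h. ?D u (h *\<^sub>R (y - x)) \<bullet> (y - x))) (at u)"
      by (rule bounded_linear.has_derivative[OF bounded_linear_inner_left])
    moreover have "?D u (h *\<^sub>R (y - x)) \<bullet> (y - x) = (?D u (y - x) \<bullet> (y - x)) * h" for h
      by (simp only: linear_scale[OF has_derivative_linear[OF dF]] inner_scaleR_left mult.commute)
    ultimately show ?thesis by (simp only: has_field_derivative_def)
  qed
  from MVT2[OF zero_less_one this] obtain u where "0 < u" "u < 1"
    "F (p 1) \<bullet> (y - x) - F (p 0) \<bullet> (y - x) = ?D u (y - x) \<bullet> (y - x)" by auto
  then show False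
    using pos[OF p[of u], of "y - x"] xy(3,4) by (simp add: p_def inner_commute)
qed

text \<open>An implicit function theorem that asks only for continuity and injectivity. Its point is
  uniformity: one \<open>\<delta>\<close> and one \<open>N\<close> serve all \<open>s\<close> and
  \<open>t\<close> near \<open>s0\<close>.\<close>

lemma family_solvable_nearby:
  fixes F :: "real \<Rightarrow> 'b::euclidean_space \<Rightarrow> 'b"
  assumes cont: "continuous_on ({0..1} \<times> U) (\<lambda>(s, y). F s y)"
    and inj: "\<And>s. 0 \<le> s \<Longrightarrow> s \<le> 1 \<Longrightarrow> inj_on (F s) U"
    and s0: "0 \<le> s0" "s0 \<le> 1" and U: "open U" "y0 \<in> U"
  obtains \<delta> N where "\<delta> > 0" "open N" "y0 \<in> N" "N \<subseteq> U"
    "\<And>s t x. s \<in> {0..1} \<Longrightarrow> t \<in> {0..1} \<Longrightarrow> \<bar>s - s0\<bar> < \<delta> \<Longrightarrow> \<bar>t - s0\<bar> < \<delta> \<Longrightarrow> x \<in> N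
      \<Longrightarrow> \<exists>y\<in>U. F s y = F t x"
proof -
  \<comment> \<open>Freezing the parameter outside \<open>[0, 1]\<close> yields an injective map on an open set, to which
    invariance of domain applies even at the end points of the interval.\<close>
  define cl :: "real \<Rightarrow> real" where "cl s = max 0 (min 1 s)" for s
  have cl: "0 \<le> cl s" "cl s \<le> 1" "s \<in> {0..1} \<Longrightarrow> cl s = s" for s by (auto simp: cl_def)
  have clc: "continuous_on UNIV cl"
    unfolding cl_def by (intro continuous_intros)
  define H where "H = (\<lambda>(s, y). F (cl s) y)"
  have contH: "continuous_on (UNIV \<times> U) H"
  proof -
    have "continuous_on (UNIV \<times> U) (\<lambda>p. (\<lambda>(s, y). F s y) (cl (fst p), snd p))"
      by (rule continuous_on_compose2[OF cont])
        (auto intro!: continuous_intros continuous_on_compose2[OF clc] simp: cl)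
    then show ?thesis by (simp add: H_def case_prod_unfold)
  qed
  have "open ((\<lambda>p. (fst p, H p)) ` (UNIV \<times> U))"
  proof (rule invariance_of_domain)
    show "inj_on (\<lambda>p. (fst p, H p)) (UNIV \<times> U)"
      using inj[OF cl(1,2)] by (auto simp: inj_on_def H_def)
  qed (auto intro!: continuous_intros contH open_Times U)
  then obtain A B where AB: "open A" "open B" "(s0, F s0 y0) \<in> A \<times> B"
    "A \<times> B \<subseteq> (\<lambda>p. (fst p, H p)) ` (UNIV \<times> U)"
    by (rule open_prod_elim[where x = "(s0, F s0 y0)"])
      (use U s0 in \<open>auto simp: H_def cl intro!: image_eqI[where x = "(s0, y0)"]\<close>)
  have "open ((UNIV \<times> U) \<inter> H -` B)"
    using contH AB(2) U by (intro continuous_open_preimage open_Times) auto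
  then obtain A' N where N: "open A'" "open N" "(s0, y0) \<in> A' \<times> N" "A' \<times> N \<subseteq> (UNIV \<times> U) \<inter> H -` B"
    by (rule open_prod_elim[where x = "(s0, y0)"]) (use U s0 AB in \<open>auto simp: H_def cl\<close>)
  \<comment> \<open>All values in \<open>A \<times> B\<close> are attained, so \<open>s\<close> has
    to lie in \<open>A\<close>; \<open>t\<close> in \<open>A'\<close> and \<open>x\<close> in
    \<open>N\<close> put \<open>F t x\<close> into \<open>B\<close>. The radius must suit both
    roles.\<close>
  have "open (A \<inter> A')" "s0 \<in> A \<inter> A'" using AB N by auto
  then obtain \<delta> where \<delta>: "\<delta> > 0" "ball s0 \<delta> \<subseteq> A \<inter> A'" using open_contains_ball by blast
  show ?thesis
  proof (rule that[OF \<delta>(1) N(2)])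
    show "y0 \<in> N" "N \<subseteq> U" using N by auto
    fix s t x assume *: "s \<in> {0..1}" "t \<in> {0..1}" "\<bar>s - s0\<bar> < \<delta>" "\<bar>t - s0\<bar> < \<delta>" "x \<in> N"
    then have "s \<in> A" "t \<in> A'" using \<delta> by (auto simp: subset_iff dist_real_def abs_minus_commute)
    then have "(s, F t x) \<in> A \<times> B" using N(4) * by (force simp: H_def cl)
    then obtain y where "y \<in> U" "F t x = F (cl s) y" using AB(4) by (auto simp: H_def)
    then show "\<exists>y\<in>U. F s y = F t x" using * cl(3) by auto
  qed
qed

section \<open>Christoffel symbols under coordinate changes\<close>

lemma sum_rotate3:
  "(\<Sum>a\<in>A. \<Sum>b\<in>B. \<Sum>c\<in>C. f a b c) = (\<Sum>c\<in>C. \<Sum>a\<in>A. \<Sum>b\<in>B. f a b c)"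
proof -
  have "(\<Sum>a\<in>A. \<Sum>b\<in>B. \<Sum>c\<in>C. f a b c) = (\<Sum>a\<in>A. \<Sum>c\<in>C. \<Sum>b\<in>B. f a b c)"
    by (rule sum.cong[OF refl], rule sum.swap)
  also have "\<dots> = (\<Sum>c\<in>C. \<Sum>a\<in>A. \<Sum>b\<in>B. f a b c)"
    by (rule sum.swap)
  finally show ?thesis .
qed

lemma sum_swap_pairs:
  "(\<Sum>a\<in>A. \<Sum>b\<in>B. \<Sum>c\<in>C. \<Sum>d\<in>D. f a b c d) = (\<Sum>c\<in>C. \<Sum>d\<in>D. \<Sum>a\<in>A. \<Sum>b\<in>B. f a b c d)"
proof -
  have "(\<Sum>a\<in>A. \<Sum>b\<in>B. \<Sum>c\<in>C. \<Sum>d\<in>D. f a b c d) =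
      (\<Sum>c\<in>C. \<Sum>a\<in>A. \<Sum>b\<in>B. \<Sum>d\<in>D. f a b c d)"
    by (rule sum_rotate3)
  also have "\<dots> = (\<Sum>c\<in>C. \<Sum>d\<in>D. \<Sum>a\<in>A. \<Sum>b\<in>B. f a b c d)"
    by (rule sum.cong[OF refl], rule sum_rotate3)
  finally show ?thesis .
qed

lemma pd_pd_compose_real:
  fixes F :: "real ^ 'n \<Rightarrow> real ^ 'm" and f :: "real ^ 'm \<Rightarrow> real"
  assumes S: "open S" "y \<in> S" "smooth_on S F" and T: "open T" "smooth_on T f" "F ` S \<subseteq> T"
  shows "pd i (pd j (\<lambda>z. f (F z))) y = (\<Sum>b\<in>UNIV. pd i (pd j F) y $ b * pd b f (F y)) +
    (\<Sum>a\<in>UNIV. \<Sum>b\<in>UNIV. pd a (pd b f) (F y) * pd i F y $ a * pd j F y $ b)"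
proof -
  have s1: "smooth_on S (\<lambda>z. pd j F z $ b)" for b
    by (intro smooth_on_nth smooth_on_pd S)
  have s2: "smooth_on S (\<lambda>z. pd b f (F z))" for b
    by (rule smooth_on_compose[OF S(1) T(1) smooth_on_pd[OF T(2)] S(3) T(3)])
  note d = smooth_on_differentiable[OF _ S(2)]
  have Fy: "F y \<in> T" using S T by auto
  have "pd i (pd j (\<lambda>z. f (F z))) y = pd i (\<lambda>z. \<Sum>b\<in>UNIV. pd j F z $ b * pd b f (F z)) y"
  proof (rule pd_cong[OF S(1,2)])
    fix z assume "z \<in> S"
    then show "pd j (\<lambda>z. f (F z)) z = (\<Sum>b\<in>UNIV. pd j F z $ b * pd b f (F z))"
      using S T by (subst pd_compose) (auto intro: smooth_on_differentiable)
  qed (intro d smooth_on_sum smooth_on_mult s1 s2 S)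
  also have "\<dots> = (\<Sum>b\<in>UNIV. pd i (\<lambda>z. pd j F z $ b * pd b f (F z)) y)"
    by (intro pd_sum d smooth_on_mult s1 s2 S) simp
  also have "\<dots> = (\<Sum>b\<in>UNIV. pd i (pd j F) y $ b * pd b f (F y) +
      pd j F y $ b * (\<Sum>a\<in>UNIV. pd i F y $ a * pd a (pd b f) (F y)))"
    by (simp add: pd_mult[OF d[OF s1] d[OF s2]] pd_nth[OF d[OF smooth_on_pd[OF S(3)]]]
        pd_compose[OF d[OF S(3)] smooth_on_differentiable[OF smooth_on_pd[OF T(2)] Fy]])
  also have "\<dots> = (\<Sum>b\<in>UNIV. pd i (pd j F) y $ b * pd b f (F y)) +
    (\<Sum>b\<in>UNIV. \<Sum>a\<in>UNIV. pd a (pd b f) (F y) * pd i F y $ a * pd j F y $ b)"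
    by (simp add: sum.distrib sum_distrib_left mult_ac)
  finally show ?thesis by (subst sum.swap)
qed

lemma pd_pd_compose:
  fixes F :: "real ^ 'n \<Rightarrow> real ^ 'm" and f :: "real ^ 'm \<Rightarrow> real ^ 'l"
  assumes S: "open S" "y \<in> S" "smooth_on S F" and T: "open T" "smooth_on T f" "F ` S \<subseteq> T"
  shows "pd i (pd j (\<lambda>z. f (F z))) y $ k = (\<Sum>b\<in>UNIV. pd i (pd j F) y $ b * pd b f (F y) $ k) +
    (\<Sum>a\<in>UNIV. \<Sum>b\<in>UNIV. pd a (pd b f) (F y) $ k * pd i F y $ a * pd j F y $ b)"
proof -
  have Fy: "F y \<in> T" using S T by auto
  show ?thesis
    by (simp add: pd_pd_nth[OF S(1,2) smooth_on_compose[OF S(1) T(1,2) S(3) T(3)]]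
      pd_pd_compose_real[OF S T(1) smooth_on_nth[OF T(1,2)] T(3)]
      pd_pd_nth[OF T(1) Fy T(2)] pd_nth[OF smooth_on_differentiable[OF T(2) Fy]])
qed

text \<open>The composition rule below is linear in the defects, so it yields both the composition and
  the cancellation of connection-preserving maps.\<close>

definition christoffel_defect :: "(real ^ 'n::finite \<Rightarrow> real ^ 'n) \<Rightarrow> real ^ 'n \<Rightarrow>
    real ^ 'n ^ 'n ^ 'n \<Rightarrow> real ^ 'n ^ 'n ^ 'n \<Rightarrow> 'n \<Rightarrow> 'n \<Rightarrow> real ^ 'n"
  where "christoffel_defect F y G H i j = (\<chi> k. (\<Sum>m\<in>UNIV. G $ m $ i $ j * pd m F y $ k) -
      pd i (pd j F) y $ k -
      (\<Sum>a\<in>UNIV. \<Sum>b\<in>UNIV. H $ k $ a $ b * pd i F y $ a * pd j F y $ b))"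

lemma christoffel_transform_iff_defect:
  "christoffel_transform F y G H \<longleftrightarrow> (\<forall>i j. christoffel_defect F y G H i j = 0)"
proof -
  have e: "x = a + b \<longleftrightarrow> x - a - b = 0" for x a b :: real by auto
  show ?thesis
    unfolding christoffel_transform_def christoffel_defect_def vec_eq_iff e by auto
qed

lemma christoffel_defect_compose:
  fixes F f :: "real ^ 'n \<Rightarrow> real ^ 'n"
  assumes S: "open S" "y \<in> S" "smooth_on S F" and T: "open T" "smooth_on T f" "F ` S \<subseteq> T"
  shows "christoffel_defect (\<lambda>z. f (F z)) y G K i j =
    (\<Sum>b\<in>UNIV. (christoffel_defect F y G H i j $ b) *\<^sub>R pd b f (F y)) +
    (\<Sum>a\<in>UNIV. \<Sum>b\<in>UNIV. (pd i F y $ a * pd j F y $ b) *\<^sub>R christoffel_defect f (F y) H K a b)"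
proof (rule vec_eq_iff[THEN iffD2], rule allI)
  fix k
  have Fy: "F y \<in> T" using S T by auto
  have c: "pd m (\<lambda>z. f (F z)) y $ k = (\<Sum>b\<in>UNIV. pd m F y $ b * pd b f (F y) $ k)" for m k
    by (simp add: pd_compose smooth_on_differentiable[OF S(3,2)] smooth_on_differentiable[OF T(2) Fy])
  define P where "P m b = pd m F y $ b" for m b
  define Q where "Q b k = pd b f (F y) $ k" for b k
  have 1: "(\<Sum>m\<in>UNIV. G $ m $ i $ j * (\<Sum>b\<in>UNIV. P m b * Q b k)) =
      (\<Sum>b\<in>UNIV. (\<Sum>m\<in>UNIV. G $ m $ i $ j * P m b) * Q b k)"
    by (simp add: sum_distrib_left sum_distrib_right mult.assoc) (rule sum.swap)
  \<comment> \<open>\<open>H\<close> is arbitrary and occurs on the right-hand side only; after this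
    reindexing its contributions to the two sums cancel.\<close>
  have 2: "(\<Sum>b\<in>UNIV. (\<Sum>a\<in>UNIV. \<Sum>c\<in>UNIV. H $ b $ a $ c * P i a * P j c) * Q b k) =
      (\<Sum>a\<in>UNIV. \<Sum>c\<in>UNIV. P i a * P j c * (\<Sum>b\<in>UNIV. H $ b $ a $ c * Q b k))"
    by (simp only: sum_distrib_right sum_distrib_left, subst sum_rotate3[symmetric])
      (simp only: mult_ac)
  have 3: "(\<Sum>a\<in>UNIV. \<Sum>b\<in>UNIV. K $ k $ a $ b * (\<Sum>c\<in>UNIV. P i c * Q c a) * (\<Sum>d\<in>UNIV. P j d * Q d b)) =
      (\<Sum>c\<in>UNIV. \<Sum>d\<in>UNIV. P i c * P j d * (\<Sum>a\<in>UNIV. \<Sum>b\<in>UNIV. K $ k $ a $ b * Q c a * Q d b))"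
  proof -
    have "K $ k $ a $ b * (\<Sum>c\<in>UNIV. P i c * Q c a) * (\<Sum>d\<in>UNIV. P j d * Q d b) =
        (\<Sum>c\<in>UNIV. \<Sum>d\<in>UNIV. P i c * P j d * (K $ k $ a $ b * Q c a * Q d b))" for a b
      by (subst mult.assoc, subst sum_product) (simp add: sum_distrib_left mult_ac)
    then show ?thesis by (simp only: sum_distrib_left) (rule sum_swap_pairs)
  qed
  show "christoffel_defect (\<lambda>z. f (F z)) y G K i j $ k =
    ((\<Sum>b\<in>UNIV. (christoffel_defect F y G H i j $ b) *\<^sub>R pd b f (F y)) +
    (\<Sum>a\<in>UNIV. \<Sum>b\<in>UNIV. (pd i F y $ a * pd j F y $ b) *\<^sub>R christoffel_defect f (F y) H K a b)) $ k"
    unfolding christoffel_defect_def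
    apply (simp add: c pd_pd_compose[OF S T])
    apply (fold P_def Q_def)
    apply (simp add: 1 3 left_diff_distrib right_diff_distrib sum_subtractf 2)
    apply (simp add: mult_ac)
    done
qed

lemma christoffel_transform_compose:
  fixes F f :: "real ^ 'n \<Rightarrow> real ^ 'n"
  assumes "open S" "y \<in> S" "smooth_on S F" "open T" "smooth_on T f" "F ` S \<subseteq> T"
    and "christoffel_transform F y G H" "christoffel_transform f (F y) H K"
  shows "christoffel_transform (\<lambda>z. f (F z)) y G K"
  using assms(7,8) unfolding christoffel_transform_iff_defect
  by (simp add: christoffel_defect_compose[OF assms(1-6), where H = H])

text \<open>Meant for a map \<open>F\<close> that is known only through its composite with a
  gradient map \<open>f\<close>, where \<open>K = 0\<close>. The composition rule reduces to the
  defect of \<open>F\<close> contracted with the derivative of \<open>f\<close>, which has trivial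
  kernel.\<close>

lemma christoffel_transform_cancel:
  fixes F f :: "real ^ 'n \<Rightarrow> real ^ 'n"
  assumes "open S" "y \<in> S" "smooth_on S F" "open T" "smooth_on T f" "F ` S \<subseteq> T"
    and "christoffel_transform (\<lambda>z. f (F z)) y G K" "christoffel_transform f (F y) H K"
    and "\<And>v. (\<Sum>b\<in>UNIV. (v $ b) *\<^sub>R pd b f (F y)) = 0 \<Longrightarrow> v = 0"
  shows "christoffel_transform F y G H"
  using assms(7,8) unfolding christoffel_transform_iff_defect
  by (auto simp: christoffel_defect_compose[OF assms(1-6), where H = H] intro: assms(9))

lemma christoffel_transform_cong:
  assumes "open S" "y \<in> S" "\<And>z. z \<in> S \<Longrightarrow> F z = F' z" "smooth_on S F"
  shows "christoffel_transform F y G H \<longleftrightarrow> christoffel_transform F' y G H"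
proof -
  have s: "smooth_on S F'" using assms smooth_on_cong by metis
  have 1: "pd j F z = pd j F' z" if "z \<in> S" for z j
    using that assms(3) smooth_on_differentiable[OF s that] by (intro pd_cong[OF assms(1)])
  have "pd i (pd j F) y = pd i (pd j F') y" for i j
    using smooth_on_differentiable[OF smooth_on_pd[OF s]] 1 assms(2)
    by (intro pd_cong[OF assms(1,2)])
  then show ?thesis by (simp add: christoffel_transform_def 1[OF assms(2)])
qed

section \<open>Positive definite matrices and the Levi-Civita connection\<close>

lemma posdef_kernel:
  fixes M :: "real ^ 'n ^ 'n"
  assumes "\<And>v. v \<noteq> 0 \<Longrightarrow> v \<bullet> (M *v v) > 0" "M *v x = 0"
  shows "x = 0"
  using assms(1)[of x] assms(2) by auto

lemma posdef_invertible:
  fixes M :: "real ^ 'n ^ 'n"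
  assumes "\<And>v. v \<noteq> 0 \<Longrightarrow> v \<bullet> (M *v v) > 0"
  shows "invertible M"
  using posdef_kernel[OF assms] matrix_left_invertible_ker[of M] by (auto simp: invertible_left_inverse)

text \<open>In matrix form \<open>M\<close> is \<open>Q\<close> times \<open>M'\<close> times the
  transpose of \<open>Q\<close>; since \<open>M\<close> is invertible, so is \<open>Q\<close>. For
  the Gram matrices of one metric in two charts this gives the invertibility of the transition
  Jacobian without recourse to the inverse transition.\<close>

lemma congruence_kernel:
  fixes M M' :: "real ^ 'n ^ 'n" and P :: "'n \<Rightarrow> 'n \<Rightarrow> real"
  assumes "\<And>v. v \<noteq> 0 \<Longrightarrow> v \<bullet> (M *v v) > 0"
    and M: "\<And>i j. M $ i $ j = (\<Sum>a\<in>UNIV. \<Sum>b\<in>UNIV. M' $ a $ b * P i a * P j b)"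
    and v: "\<And>i. (\<Sum>a\<in>UNIV. P i a * v $ a) = 0"
  shows "v = 0"
proof -
  define Q where "Q = (\<chi> i a. P i a)"
  have "M = Q ** (M' ** transpose Q)"
    by (simp add: vec_eq_iff M matrix_matrix_mult_def Q_def transpose_def sum_distrib_left mult_ac)
  then have "invertible Q"
    using posdef_invertible[OF assms(1)] by (auto simp: invertible_det_nz det_mul)
  moreover have "Q *v v = 0"
    by (simp add: vec_eq_iff matrix_vector_mult_def Q_def v)
  ultimately show ?thesis
    using matrix_left_invertible_ker[of Q] by (auto simp: invertible_left_inverse)
qed

lemma matrix_inv_right: "invertible M \<Longrightarrow> M ** matrix_inv M = mat 1"
  unfolding matrix_inv_def invertible_def by (rule someI_ex[THEN conjunct1])

text \<open>Lowering the upper index removes \<open>matrix_inv\<close>; both later computations with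
  \<open>levi_civita\<close> are done in this form.\<close>

lemma levi_civita_lower:
  assumes "\<And>v. v \<noteq> 0 \<Longrightarrow> v \<bullet> (g c y *v v) > 0"
  shows "(\<Sum>k\<in>UNIV. g c y $ l $ k * levi_civita g c y $ k $ i $ j) =
    (1 / 2) * (pd i (g c) y $ j $ l + pd j (g c) y $ i $ l - pd l (g c) y $ i $ j)"
proof -
  let ?M = "g c y"
  define X where "X l = pd i (g c) y $ j $ l + pd j (g c) y $ i $ l - pd l (g c) y $ i $ j" for l
  have "(\<Sum>k\<in>UNIV. ?M $ l $ k * levi_civita g c y $ k $ i $ j) =
    (1 / 2) * (\<Sum>k\<in>UNIV. \<Sum>l'\<in>UNIV. ?M $ l $ k * matrix_inv ?M $ k $ l' * X l')"
    by (simp add: levi_civita_def sum_distrib_left mult_ac X_def)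
  also have "\<dots> = (1 / 2) * (\<Sum>l'\<in>UNIV. (?M ** matrix_inv ?M) $ l $ l' * X l')"
    by (subst sum.swap) (simp add: matrix_matrix_mult_def sum_distrib_right)
  also have "\<dots> = (1 / 2) * X l"
    by (subst matrix_inv_right[OF posdef_invertible[OF assms]]) (auto simp: mat_def if_distrib[of "\<lambda>a. a * _"] cong: if_cong)
  finally show ?thesis by (simp add: X_def)
qed

lemma pd_nth_nth:
  assumes "f differentiable (at y)"
  shows "pd i (\<lambda>z. f z $ k $ l) y = pd i f y $ k $ l"
proof -
  have "(\<lambda>z. f z $ k) differentiable (at y)"
    using bounded_linear.has_derivative[OF bounded_linear_vec_nth frechet_derivative_worksI[OF assms]]
    by (auto simp: differentiable_def)
  from pd_nth[OF this] show ?thesis by (simp add: pd_nth[OF assms])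
qed

text \<open>For fixed \<open>i\<close>, \<open>j\<close> the defect of the transformation law is a
  vector \<open>X\<close>. Lowered with \<open>g d\<close> and contracted with the Jacobian it
  becomes zero, and neither operation has a kernel.\<close>

lemma levi_civita_transform:
  fixes T :: "real ^ 'n \<Rightarrow> real ^ 'n"
  assumes S: "open S" "y \<in> S" "smooth_on S T" and U: "open U" "T ` S \<subseteq> U"
    and sm: "smooth_on S (g c)" "smooth_on U (g d)"
    and gt: "\<And>z i j. z \<in> S \<Longrightarrow> g c z $ i $ j =
      (\<Sum>a\<in>UNIV. \<Sum>b\<in>UNIV. g d (T z) $ a $ b * pd i T z $ a * pd j T z $ b)"
    and sym: "transpose (g d (T y)) = g d (T y)"
    and posc: "\<And>v. v \<noteq> 0 \<Longrightarrow> v \<bullet> (g c y *v v) > 0"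
    and posd: "\<And>v. v \<noteq> 0 \<Longrightarrow> v \<bullet> (g d (T y) *v v) > 0"
  shows "christoffel_transform T y (levi_civita g c y) (levi_civita g d (T y))"
proof -
  have Ty: "T y \<in> U" using S U by auto
  define P where "P i a = pd i T y $ a" for i a
  define PP where "PP i j a = pd i (pd j T) y $ a" for i j a
  define G where "G a b = g d (T y) $ a $ b" for a b
  define DG where "DG e a b = pd e (g d) (T y) $ a $ b" for e a b
  \<comment> \<open>In the derivative of \<open>g c\<close>, \<open>A\<close> collects the terms
    that differentiate \<open>g d\<close> and \<open>B\<close> those that differentiate the
    Jacobian. As \<open>B\<close> is symmetric in its first two indices, only \<open>B i j l\<close>
    survives in the Christoffel combination, and it accounts for the second derivative of
    \<open>T\<close> in the transformation law.\<close>
  define A where "A i j l = (\<Sum>e\<in>UNIV. \<Sum>a\<in>UNIV. \<Sum>b\<in>UNIV. DG e a b * P i e * P j a * P l b)" for i j l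
  define B where "B i j l = (\<Sum>a\<in>UNIV. \<Sum>b\<in>UNIV. G a b * PP i j a * P l b)" for i j l
  have Gs: "G a b = G b a" for a b
    using arg_cong[OF sym, of "\<lambda>M. M $ b $ a"] by (simp add: G_def transpose_def)
  have PPs: "PP i j a = PP j i a" for i j a
    by (simp add: PP_def pd_commute[OF S(1,2,3), of i j])
  have dg: "pd l (g c) y $ i $ j = A l i j + B l i j + B l j i" for l i j
  proof -
    note d = smooth_on_differentiable[OF _ S(2)]
    have s1: "smooth_on S (\<lambda>z. g d (T z) $ a $ b)" for a b
      by (intro smooth_on_nth S smooth_on_compose[OF S(1) U(1) sm(2) S(3) U(2)])
    have s2: "smooth_on S (\<lambda>z. pd i T z $ a)" for i a
      by (intro smooth_on_nth smooth_on_pd S)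
    have "pd l (g c) y $ i $ j = pd l (\<lambda>z. g c z $ i $ j) y"
      by (rule pd_nth_nth[OF d[OF sm(1)], symmetric])
    also have "\<dots> = pd l (\<lambda>z. \<Sum>a\<in>UNIV. \<Sum>b\<in>UNIV. g d (T z) $ a $ b * pd i T z $ a * pd j T z $ b) y"
      by (rule pd_cong[OF S(1,2) gt]) (auto intro!: d smooth_on_sum smooth_on_mult s1 s2 S)
    also have "\<dots> = (\<Sum>a\<in>UNIV. pd l (\<lambda>z. \<Sum>b\<in>UNIV. g d (T z) $ a $ b * pd i T z $ a * pd j T z $ b) y)"
      by (intro pd_sum d smooth_on_sum smooth_on_mult s1 s2 S) simp
    also have "\<dots> = (\<Sum>a\<in>UNIV. \<Sum>b\<in>UNIV. pd l (\<lambda>z. g d (T z) $ a $ b * pd i T z $ a * pd j T z $ b) y)"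
      by (intro sum.cong refl pd_sum d smooth_on_sum smooth_on_mult s1 s2 S) simp
    also have "\<dots> = (\<Sum>a\<in>UNIV. \<Sum>b\<in>UNIV. (pd l (\<lambda>z. g d (T z) $ a $ b) y * P i a + G a b * PP l i a) * P j b
        + G a b * P i a * PP l j b)"
      by (simp add: pd_mult d s1 s2 smooth_on_mult S(1) P_def PP_def G_def pd_nth smooth_on_pd[OF S(3)])
    also have "\<dots> = (\<Sum>a\<in>UNIV. \<Sum>b\<in>UNIV. (\<Sum>e\<in>UNIV. DG e a b * P l e * P i a * P j b)
        + G a b * PP l i a * P j b + G a b * P i a * PP l j b)"
    proof -
      have "pd l (\<lambda>z. g d (T z) $ a $ b) y = (\<Sum>e\<in>UNIV. P l e * DG e a b)" for a b
        using pd_nth_nth[OF smooth_on_differentiable[OF sm(2) Ty]]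
          smooth_on_differentiable[OF smooth_on_nth[OF U(1) smooth_on_nth[OF U(1) sm(2)]] Ty]
        by (subst pd_compose[OF d[OF S(3)], where G = "\<lambda>z. g d z $ a $ b"]) (auto simp: P_def DG_def)
      then show ?thesis by (simp add: sum_distrib_left sum_distrib_right algebra_simps)
    qed
    also have "\<dots> = (\<Sum>a\<in>UNIV. \<Sum>b\<in>UNIV. \<Sum>e\<in>UNIV. DG e a b * P l e * P i a * P j b) + B l i j
        + (\<Sum>a\<in>UNIV. \<Sum>b\<in>UNIV. G a b * P i a * PP l j b)"
      by (simp add: sum.distrib B_def)
    also have "(\<Sum>a\<in>UNIV. \<Sum>b\<in>UNIV. G a b * P i a * PP l j b) = B l j i"
      unfolding B_def by (subst sum.swap) (simp add: mult_ac Gs)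
    also have "(\<Sum>a\<in>UNIV. \<Sum>b\<in>UNIV. \<Sum>e\<in>UNIV. DG e a b * P l e * P i a * P j b) = A l i j"
      unfolding A_def by (rule sum_rotate3)
    finally show ?thesis .
  qed
  show ?thesis
    unfolding christoffel_transform_iff_defect
  proof (intro allI)
    fix i j
    define L1 where "L1 m = levi_civita g c y $ m $ i $ j" for m
    define L2 where "L2 k a b = levi_civita g d (T y) $ k $ a $ b" for k a b
    define X where "X = christoffel_defect T y (levi_civita g c y) (levi_civita g d (T y)) i j"
    define W where "W l = (1 / 2) * (A i j l + A j i l - A l i j)" for l
    have X: "X $ k = (\<Sum>m\<in>UNIV. L1 m * P m k) - PP i j k -
      (\<Sum>a\<in>UNIV. \<Sum>b\<in>UNIV. L2 k a b * P i a * P j b)" for k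
      by (simp add: X_def christoffel_defect_def L1_def L2_def P_def PP_def)
    have Bs: "B i j l = B j i l" for i j l
      by (simp add: B_def PPs[of i j])
    have low1: "(\<Sum>m\<in>UNIV. g c y $ l $ m * L1 m) = W l + B i j l" for l
    proof -
      have "(\<Sum>m\<in>UNIV. g c y $ l $ m * L1 m) =
          (1 / 2) * (pd i (g c) y $ j $ l + pd j (g c) y $ i $ l - pd l (g c) y $ i $ j)"
        unfolding L1_def by (rule levi_civita_lower) (rule posc)
      then show ?thesis
        unfolding dg W_def using Bs[of i j l] Bs[of i l j] Bs[of j l i] by (simp add: field_simps)
    qed
    have low2: "(\<Sum>k\<in>UNIV. G e k * L2 k a b) = (1 / 2) * (DG a b e + DG b a e - DG e a b)" for e a b
      unfolding L2_def G_def DG_def by (rule levi_civita_lower) (rule posd)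
    have g1: "g c y $ l $ m = (\<Sum>e\<in>UNIV. \<Sum>k\<in>UNIV. G e k * P l e * P m k)" for l m
      using gt[OF S(2)] by (simp add: G_def P_def)
    have E1: "(\<Sum>e\<in>UNIV. \<Sum>k\<in>UNIV. P l e * G e k * (\<Sum>m\<in>UNIV. L1 m * P m k)) = W l + B i j l" for l
      unfolding low1[symmetric] g1
      by (simp only: sum_distrib_left sum_distrib_right, subst sum_rotate3) (simp only: mult_ac)
    have E2: "(\<Sum>e\<in>UNIV. \<Sum>k\<in>UNIV. P l e * G e k * PP i j k) = B i j l" for l
      unfolding B_def by (subst sum.swap) (simp add: Gs mult_ac)
    have E3: "(\<Sum>e\<in>UNIV. \<Sum>k\<in>UNIV. P l e * G e k * (\<Sum>a\<in>UNIV. \<Sum>b\<in>UNIV. L2 k a b * P i a * P j b)) = W l" for l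
    proof -
      have "(\<Sum>e\<in>UNIV. \<Sum>k\<in>UNIV. P l e * G e k * (\<Sum>a\<in>UNIV. \<Sum>b\<in>UNIV. L2 k a b * P i a * P j b))
        = (\<Sum>a\<in>UNIV. \<Sum>b\<in>UNIV. \<Sum>e\<in>UNIV. (\<Sum>k\<in>UNIV. G e k * L2 k a b) * (P i a * P j b * P l e))"
        by (simp only: sum_distrib_left sum_distrib_right, subst sum_swap_pairs) (simp only: mult_ac)
      also have "\<dots> = (1 / 2) * ((\<Sum>a\<in>UNIV. \<Sum>b\<in>UNIV. \<Sum>e\<in>UNIV. DG a b e * P i a * P j b * P l e)
          + (\<Sum>a\<in>UNIV. \<Sum>b\<in>UNIV. \<Sum>e\<in>UNIV. DG b a e * P j b * P i a * P l e)
          - (\<Sum>a\<in>UNIV. \<Sum>b\<in>UNIV. \<Sum>e\<in>UNIV. DG e a b * P l e * P i a * P j b))"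
        unfolding low2
        by (simp add: sum_distrib_left sum.distrib[symmetric] sum_subtractf[symmetric] algebra_simps)
      also have "(\<Sum>a\<in>UNIV. \<Sum>b\<in>UNIV. \<Sum>e\<in>UNIV. DG e a b * P l e * P i a * P j b) = A l i j"
        unfolding A_def by (rule sum_rotate3)
      also have "(\<Sum>a\<in>UNIV. \<Sum>b\<in>UNIV. \<Sum>e\<in>UNIV. DG b a e * P j b * P i a * P l e) = A j i l"
        unfolding A_def by (rule sum.swap)
      finally show ?thesis by (simp add: W_def A_def)
    qed
    \<comment> \<open>The three terms of \<open>X\<close> contribute \<open>W l + B i j l\<close>,
      \<open>B i j l\<close> and \<open>W l\<close>.\<close>
    have "(\<Sum>e\<in>UNIV. \<Sum>k\<in>UNIV. P l e * G e k * X $ k) = 0" for l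
      using E1[of l] E2[of l] E3[of l] by (simp add: X right_diff_distrib sum_subtractf)
    then have "(\<Sum>e\<in>UNIV. P l e * (g d (T y) *v X) $ e) = 0" for l
      by (simp add: matrix_vector_mult_def G_def sum_distrib_left mult_ac)
    then have "g d (T y) *v X = 0"
      using congruence_kernel[where M = "g c y" and M' = "g d (T y)" and P = P] posc g1
      by (simp add: G_def)
    then have "X = 0" by (rule posdef_kernel[rotated]) (rule posd)
    then show "christoffel_defect T y (levi_civita g c y) (levi_civita g d (T y)) i j = 0"
      by (simp add: X_def)
  qed
qed

section \<open>Charts and affine maps\<close>

lemma
  assumes "is_chart c"
  shows chart_open: "open (fst c)" "open (chart_image c)"
    and chart_continuous: "continuous_on (fst c) (snd c)" "continuous_on (chart_image c) (chart_inv c)"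
    and chart_inv_in: "\<And>y. y \<in> chart_image c \<Longrightarrow> chart_inv c y \<in> fst c"
    and chart_chart_inv: "\<And>y. y \<in> chart_image c \<Longrightarrow> snd c (chart_inv c y) = y"
    and chart_inv_chart: "\<And>x. x \<in> fst c \<Longrightarrow> chart_inv c (snd c x) = x"
    and chart_in_image: "\<And>x. x \<in> fst c \<Longrightarrow> snd c x \<in> chart_image c"
  using assms unfolding is_chart_def homeomorphism_def by auto

lemma mem_local_dom:
  assumes "is_chart c"
  shows "y \<in> local_dom c d f \<longleftrightarrow> y \<in> chart_image c \<and> f (chart_inv c y) \<in> fst d"
proof
  assume "y \<in> local_dom c d f"
  then obtain x where "x \<in> fst c" "f x \<in> fst d" "y = snd c x"
    unfolding local_dom_def by blast
  then show "y \<in> chart_image c \<and> f (chart_inv c y) \<in> fst d"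
    by (simp add: chart_inv_chart[OF assms] chart_in_image[OF assms])
next
  assume "y \<in> chart_image c \<and> f (chart_inv c y) \<in> fst d"
  then show "y \<in> local_dom c d f"
    unfolding local_dom_def
    by (intro image_eqI[where x = "chart_inv c y"])
      (simp_all add: chart_chart_inv[OF assms] chart_inv_in[OF assms])
qed

lemma local_rep_chart:
  "is_chart c \<Longrightarrow> x \<in> fst c \<Longrightarrow> local_rep c d f (snd c x) = snd d (f x)"
  by (simp add: local_rep_def chart_inv_chart)

lemma open_chart_preimage:
  assumes "is_chart c" "open W"
  shows "open (fst c \<inter> snd c -` W)"
  using continuous_open_preimage[OF chart_continuous(1) chart_open(1)] assms by blast

lemma open_chart_image_of:
  assumes "is_chart c" "open U" "U \<subseteq> fst c"
  shows "open (snd c ` U)"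
proof -
  have "snd c ` U = chart_image c \<inter> chart_inv c -` U"
  proof (intro equalityI subsetI)
    fix y assume "y \<in> snd c ` U"
    then show "y \<in> chart_image c \<inter> chart_inv c -` U"
      using assms(3) chart_inv_chart[OF assms(1)] chart_in_image[OF assms(1)] by auto
  next
    fix y assume "y \<in> chart_image c \<inter> chart_inv c -` U"
    then have "y = snd c (chart_inv c y)" "chart_inv c y \<in> U"
      using chart_chart_inv[OF assms(1)] by auto
    then show "y \<in> snd c ` U" by blast
  qed
  then show ?thesis
    using continuous_open_preimage[OF chart_continuous(2)[OF assms(1)] chart_open(2)[OF assms(1)] assms(2)]
    by simp
qed

lemma open_local_dom:
  assumes "is_chart c" "is_chart d" "continuous_on UNIV f"
  shows "open (local_dom c d f)"
proof -
  have "open (fst c \<inter> f -` fst d)"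
    by (rule open_Int[OF chart_open(1)[OF assms(1)] open_vimage[OF chart_open(1)[OF assms(2)] assms(3)]])
  then show ?thesis
    unfolding local_dom_def by (rule open_chart_image_of[OF assms(1)]) simp
qed

lemma
  assumes "smooth_structure A"
  shows smooth_structure_chart: "\<And>c. c \<in> A \<Longrightarrow> is_chart c"
    and smooth_structure_cover: "\<And>p. \<exists>c\<in>A. p \<in> fst c"
    and smooth_structure_transition:
      "\<And>c d. c \<in> A \<Longrightarrow> d \<in> A \<Longrightarrow> smooth_on (local_dom c d id) (local_rep c d id)"
proof -
  note S = assms[unfolded smooth_structure_def]
  show "\<And>c. c \<in> A \<Longrightarrow> is_chart c" using S[THEN conjunct1] by blast
  show "\<And>p. \<exists>c\<in>A. p \<in> fst c" using S[THEN conjunct2, THEN conjunct1] by blast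
  show "\<And>c d. c \<in> A \<Longrightarrow> d \<in> A \<Longrightarrow> smooth_on (local_dom c d id) (local_rep c d id)"
    using S[THEN conjunct2, THEN conjunct2, THEN conjunct1] unfolding compatible_def by blast
qed

text \<open>Smoothness near \<open>x\<close> and the transformation law at \<open>x\<close>, for one
  pair of charts. In this pointwise form the condition composes, and verifying it in one convenient
  pair of charts around each point will be enough.\<close>

definition affine_germ :: "('a, 'n::finite) connection \<Rightarrow> ('b, 'n) connection \<Rightarrow> ('a \<Rightarrow> 'b) \<Rightarrow>
    ('a, 'n) chart \<Rightarrow> ('b, 'n) chart \<Rightarrow> 'a \<Rightarrow> bool"
  where "affine_germ \<Gamma> \<Delta> f c d x \<longleftrightarrow>
    (\<exists>W. open W \<and> snd c x \<in> W \<and> W \<subseteq> local_dom c d f \<and> smooth_on W (local_rep c d f)) \<and>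
    christoffel_transform (local_rep c d f) (snd c x) (\<Gamma> c (snd c x)) (\<Delta> d (snd d (f x)))"

lemma affine_germ_compose:
  assumes ch: "is_chart c" "is_chart d" "x \<in> fst c"
    and f: "affine_germ \<Gamma> \<Delta> f c d x" and h: "affine_germ \<Delta> \<Theta> h d e (f x)"
  shows "affine_germ \<Gamma> \<Theta> (h \<circ> f) c e x"
proof -
  let ?F = "local_rep c d f" and ?H = "local_rep d e h"
  obtain W where W: "open W" "snd c x \<in> W" "W \<subseteq> local_dom c d f" "smooth_on W ?F"
    using f unfolding affine_germ_def by blast
  obtain V where V: "open V" "snd d (f x) \<in> V" "V \<subseteq> local_dom d e h" "smooth_on V ?H"
    using h unfolding affine_germ_def by blast
  define U where "U = W \<inter> ?F -` V"
  have U: "open U" "snd c x \<in> U" "U \<subseteq> W" "?F ` U \<subseteq> V"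
    unfolding U_def
    using continuous_open_preimage[OF smooth_on_continuous_on[OF W(4)] W(1) V(1)] W(2) V(2) ch
    by (auto simp: local_rep_chart)
  have sF: "smooth_on U ?F" using smooth_on_subset[OF W(4) U(3)] .
  have in_d: "f (chart_inv c z) \<in> fst d" "z \<in> chart_image c" if "z \<in> U" for z
    using that U(3) W(3) mem_local_dom[OF ch(1), of z d f] by auto
  have eq: "?H (?F z) = local_rep c e (h \<circ> f) z" if "z \<in> U" for z
    using in_d[OF that] by (simp add: local_rep_def chart_inv_chart[OF ch(2)])
  have sm: "smooth_on U (\<lambda>z. ?H (?F z))"
    by (rule smooth_on_compose[OF U(1) V(1,4) sF U(4)])
  have "U \<subseteq> local_dom c e (h \<circ> f)"
  proof
    fix z assume z: "z \<in> U"
    then have "?F z \<in> local_dom d e h" using U V by auto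
    then show "z \<in> local_dom c e (h \<circ> f)"
      using in_d[OF z] by (auto simp: mem_local_dom[OF ch(1)] mem_local_dom[OF ch(2)] local_rep_def
        chart_inv_chart[OF ch(2)])
  qed
  moreover have "smooth_on U (local_rep c e (h \<circ> f))"
    using smooth_on_cong[OF U(1), of "\<lambda>z. ?H (?F z)" "local_rep c e (h \<circ> f)"] eq sm by blast
  moreover have "christoffel_transform (\<lambda>z. ?H (?F z)) (snd c x) (\<Gamma> c (snd c x)) (\<Theta> e (snd e (h (f x))))"
    by (rule christoffel_transform_compose[OF U(1,2) sF V(1,4) U(4), where H = "\<Delta> d (snd d (f x))"])
      (use f h ch in \<open>auto simp: affine_germ_def local_rep_chart\<close>)
  then have "christoffel_transform (local_rep c e (h \<circ> f)) (snd c x) (\<Gamma> c (snd c x)) (\<Theta> e (snd e (h (f x))))"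
    using christoffel_transform_cong[OF U(1,2) _ sm, of "local_rep c e (h \<circ> f)"] eq by blast
  ultimately show ?thesis
    unfolding affine_germ_def using U(1,2) by auto
qed

definition affine_map :: "('a::topological_space, 'n::finite) chart set \<Rightarrow>
    ('a, 'n) connection \<Rightarrow> ('a, 'n) connection \<Rightarrow> ('a \<Rightarrow> 'a) \<Rightarrow> bool"
  where "affine_map A \<Gamma> \<Delta> f \<longleftrightarrow> continuous_on UNIV f \<and>
    (\<forall>c\<in>A. \<forall>d\<in>A. \<forall>x\<in>fst c. f x \<in> fst d \<longrightarrow> affine_germ \<Gamma> \<Delta> f c d x)"

lemma affine_map_germ:
  "affine_map A \<Gamma> \<Delta> f \<Longrightarrow> c \<in> A \<Longrightarrow> d \<in> A \<Longrightarrow> x \<in> fst c \<Longrightarrow> f x \<in> fst d \<Longrightarrow>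
    affine_germ \<Gamma> \<Delta> f c d x"
  by (simp add: affine_map_def)

lemma affine_map_compose:
  assumes A: "smooth_structure A" and f: "affine_map A \<Gamma> \<Delta> f" and h: "affine_map A \<Delta> \<Theta> h"
  shows "affine_map A \<Gamma> \<Theta> (h \<circ> f)"
  unfolding affine_map_def
proof (intro conjI ballI impI)
  have "continuous_on UNIV f" "continuous_on UNIV h"
    using f h by (simp_all add: affine_map_def)
  then show "continuous_on UNIV (h \<circ> f)"
    using continuous_on_compose continuous_on_subset by blast
next
  fix c d x assume *: "c \<in> A" "d \<in> A" "x \<in> fst c" "(h \<circ> f) x \<in> fst d"
  obtain e where e: "e \<in> A" "f x \<in> fst e" using smooth_structure_cover[OF A] by blast
  show "affine_germ \<Gamma> \<Theta> (h \<circ> f) c d x"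
    by (rule affine_germ_compose[OF smooth_structure_chart[OF A *(1)] smooth_structure_chart[OF A e(1)] *(3)
        affine_map_germ[OF f *(1) e(1) *(3) e(2)] affine_map_germ[OF h e(1) *(2) e(2)]])
      (use *(4) in simp)
qed

text \<open>The inverse is supplied as a second affine map. This makes symmetry immediate, and the
  matching relation below produces both maps in the same way.\<close>

definition affinely_equivalent :: "('a::topological_space, 'n::finite) chart set \<Rightarrow>
    ('a, 'n) connection \<Rightarrow> ('a, 'n) connection \<Rightarrow> bool"
  where "affinely_equivalent A \<Gamma> \<Delta> \<longleftrightarrow> (\<exists>f h. affine_map A \<Gamma> \<Delta> f \<and> affine_map A \<Delta> \<Gamma> h \<and>
    h \<circ> f = id \<and> f \<circ> h = id)"

lemma affinely_equivalent_sym: "affinely_equivalent A \<Gamma> \<Delta> \<Longrightarrow> affinely_equivalent A \<Delta> \<Gamma>"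
  unfolding affinely_equivalent_def by blast

lemma affinely_equivalent_trans:
  assumes A: "smooth_structure A"
    and "affinely_equivalent A \<Gamma> \<Delta>" "affinely_equivalent A \<Delta> \<Theta>"
  shows "affinely_equivalent A \<Gamma> \<Theta>"
proof -
  obtain f h where f: "affine_map A \<Gamma> \<Delta> f" "affine_map A \<Delta> \<Gamma> h" "h \<circ> f = id" "f \<circ> h = id"
    using assms(2) unfolding affinely_equivalent_def by blast
  obtain f' h' where f': "affine_map A \<Delta> \<Theta> f'" "affine_map A \<Theta> \<Delta> h'" "h' \<circ> f' = id" "f' \<circ> h' = id"
    using assms(3) unfolding affinely_equivalent_def by blast
  have "(h \<circ> h') \<circ> (f' \<circ> f) = id" "(f' \<circ> f) \<circ> (h \<circ> h') = id"
    using f(3,4) f'(3,4) by (simp_all add: fun_eq_iff)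
  then show ?thesis
    unfolding affinely_equivalent_def
    using affine_map_compose[OF A f(1) f'(1)] affine_map_compose[OF A f'(2) f(2)] by blast
qed

lemma affine_isomorphism_if_equivalent:
  assumes A: "smooth_structure A" and "affinely_equivalent A \<Gamma> \<Delta>"
  shows "\<exists>f. affine_isomorphism A \<Gamma> A \<Delta> f"
proof -
  obtain f h where f: "affine_map A \<Gamma> \<Delta> f" "affine_map A \<Delta> \<Gamma> h" "h \<circ> f = id" "f \<circ> h = id"
    using assms(2) unfolding affinely_equivalent_def by blast
  have germ: "affine_germ G H k c d (chart_inv c y)" "snd c (chart_inv c y) = y"
    if k: "affine_map A G H k" "c \<in> A" "d \<in> A" and y: "y \<in> local_dom c d k" for G H k c d y
  proof -
    note c = smooth_structure_chart[OF A k(2)]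
    have "y \<in> chart_image c" "k (chart_inv c y) \<in> fst d" using y mem_local_dom[OF c] by blast+
    then show "affine_germ G H k c d (chart_inv c y)" "snd c (chart_inv c y) = y"
      using affine_map_germ[OF k] chart_inv_in[OF c] chart_chart_inv[OF c] by auto
  qed
  have smooth: "smooth_map A A k" if k: "affine_map A G H k" for G H k
    unfolding smooth_map_def
  proof (intro conjI ballI)
    show "continuous_on UNIV k" using k by (simp add: affine_map_def)
    fix c d assume cd: "c \<in> A" "d \<in> A"
    show "smooth_on (local_dom c d k) (local_rep c d k)"
    proof (rule smooth_on_local)
      fix y assume "y \<in> local_dom c d k"
      from germ[OF k cd this] show "\<exists>T. open T \<and> y \<in> T \<and> smooth_on T (local_rep c d k)"
        unfolding affine_germ_def by auto
    qed
  qed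
  have "bij f" using f(3,4) o_bij by blast
  moreover have "inv f = h" using f(3,4) inv_unique_comp by blast
  moreover have "christoffel_transform (local_rep c d f) y (\<Gamma> c y) (\<Delta> d (local_rep c d f y))"
    if "c \<in> A" "d \<in> A" "y \<in> local_dom c d f" for c d y
    using germ[OF f(1) that] by (simp add: affine_germ_def local_rep_def)
  ultimately have "affine_isomorphism A \<Gamma> A \<Delta> f"
    unfolding affine_isomorphism_def diffeo_def using smooth[OF f(1)] smooth[OF f(2)] by simp
  then show ?thesis by (rule exI[of _ f])
qed

section \<open>Metrics and dual connections under a change of charts\<close>

lemma
  assumes "riemannian_metric A g"
  shows riemannian_metric_smooth: "\<And>c. c \<in> A \<Longrightarrow> smooth_on (chart_image c) (g c)"
    and riemannian_metric_sym: "\<And>c y. c \<in> A \<Longrightarrow> y \<in> chart_image c \<Longrightarrow> transpose (g c y) = g c y"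
    and riemannian_metric_pos:
      "\<And>c y v. c \<in> A \<Longrightarrow> y \<in> chart_image c \<Longrightarrow> v \<noteq> 0 \<Longrightarrow> v \<bullet> (g c y *v v) > 0"
    and riemannian_metric_change:
      "\<And>c d y i j. c \<in> A \<Longrightarrow> d \<in> A \<Longrightarrow> y \<in> local_dom c d id \<Longrightarrow>
        g c y $ i $ j = (\<Sum>a\<in>UNIV. \<Sum>b\<in>UNIV. g d (local_rep c d id y) $ a $ b *
          pd i (local_rep c d id) y $ a * pd j (local_rep c d id) y $ b)"
proof -
  note R = assms[unfolded riemannian_metric_def]
  show "\<And>c. c \<in> A \<Longrightarrow> smooth_on (chart_image c) (g c)" using R[THEN conjunct1] by blast
  show "\<And>c y. c \<in> A \<Longrightarrow> y \<in> chart_image c \<Longrightarrow> transpose (g c y) = g c y"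
    "\<And>c y v. c \<in> A \<Longrightarrow> y \<in> chart_image c \<Longrightarrow> v \<noteq> 0 \<Longrightarrow> v \<bullet> (g c y *v v) > 0"
    using R[THEN conjunct2, THEN conjunct1] by simp_all
  show "\<And>c d y i j. c \<in> A \<Longrightarrow> d \<in> A \<Longrightarrow> y \<in> local_dom c d id \<Longrightarrow>
        g c y $ i $ j = (\<Sum>a\<in>UNIV. \<Sum>b\<in>UNIV. g d (local_rep c d id y) $ a $ b *
          pd i (local_rep c d id) y $ a * pd j (local_rep c d id) y $ b)"
    by (rule R[THEN conjunct2, THEN conjunct2, rule_format])
qed

text \<open>The transformation law is inhomogeneous, but it is preserved by combinations whose
  coefficients have sum 1: here the second derivative of the transition enters with weight 2 -
  1.\<close>

lemma dual_connection_transform: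
  assumes A: "smooth_structure A" and \<Gamma>: "is_connection A \<Gamma>" and g: "riemannian_metric A g"
    and cd: "c \<in> A" "d \<in> A" "y \<in> local_dom c d id"
  shows "christoffel_transform (local_rep c d id) y (dual_connection \<Gamma> g c y)
    (dual_connection \<Gamma> g d (local_rep c d id y))"
proof -
  let ?T = "local_rep c d id"
  note ch = smooth_structure_chart[OF A cd(1)] smooth_structure_chart[OF A cd(2)]
    smooth_structure_transition[OF A cd(1,2)]
  have dom: "z \<in> chart_image c \<and> chart_inv c z \<in> fst d" if "z \<in> local_dom c d id" for z
    using mem_local_dom[OF ch(1), of z d id] that by simp
  then have sub: "local_dom c d id \<subseteq> chart_image c" by blast
  have im: "?T ` local_dom c d id \<subseteq> chart_image d"
    using chart_in_image[OF ch(2)] dom by (auto simp: local_rep_def)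
  have y: "y \<in> chart_image c" "?T y \<in> chart_image d" using sub im cd by auto
  have G: "christoffel_transform ?T y (\<Gamma> c y) (\<Gamma> d (?T y))"
    using \<Gamma> cd unfolding is_connection_def by blast
  have "christoffel_transform ?T y (levi_civita g c y) (levi_civita g d (?T y))"
  proof (rule levi_civita_transform[OF _ cd(3) _ chart_open(2)[OF ch(2)] im])
    show "open (local_dom c d id)" by (rule open_local_dom[OF ch(1,2)]) simp
    show "smooth_on (local_dom c d id) ?T" by (rule ch(3))
    show "smooth_on (local_dom c d id) (g c)"
      by (rule smooth_on_subset[OF riemannian_metric_smooth[OF g cd(1)] sub])
    show "smooth_on (chart_image d) (g d)" by (rule riemannian_metric_smooth[OF g cd(2)])
    show "g c z $ i $ j = (\<Sum>a\<in>UNIV. \<Sum>b\<in>UNIV. g d (?T z) $ a $ b * pd i ?T z $ a * pd j ?T z $ b)"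
      if "z \<in> local_dom c d id" for z i j
      by (rule riemannian_metric_change[OF g cd(1,2) that])
    show "transpose (g d (?T y)) = g d (?T y)" by (rule riemannian_metric_sym[OF g cd(2) y(2)])
  qed (rule riemannian_metric_pos[OF g cd(1) y(1)] riemannian_metric_pos[OF g cd(2) y(2)]; assumption)+
  then show ?thesis
    using G unfolding christoffel_transform_def dual_connection_def
    by (simp add: left_diff_distrib sum_subtractf mult.assoc sum_distrib_left[symmetric])
qed

lemma affine_germ_id:
  assumes A: "smooth_structure A"
    and G: "\<And>y. y \<in> local_dom c d id \<Longrightarrow>
      christoffel_transform (local_rep c d id) y (\<Gamma> c y) (\<Gamma> d (local_rep c d id y))"
    and cd: "c \<in> A" "d \<in> A" "x \<in> fst c" "x \<in> fst d"
  shows "affine_germ \<Gamma> \<Gamma> id c d x"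
proof -
  note ch = smooth_structure_chart[OF A cd(1)] smooth_structure_chart[OF A cd(2)]
    smooth_structure_transition[OF A cd(1,2)]
  have "open (local_dom c d id)" by (rule open_local_dom[OF ch(1,2)]) simp
  moreover have "snd c x \<in> local_dom c d id"
    using cd ch by (simp add: mem_local_dom chart_inv_chart chart_in_image)
  ultimately show ?thesis
    unfolding affine_germ_def
    using ch G[of "snd c x"] cd by (auto simp: local_rep_chart)
qed

text \<open>The identity is an affine germ between any two charts, so composing with it on both
  sides moves a germ to another pair of charts. The isomorphism therefore has to be examined in
  gradient charts only.\<close>

lemma affine_germ_change_charts:
  assumes A: "smooth_structure A" and \<Gamma>: "is_connection A \<Gamma>"
    and g: "riemannian_metric A g" "riemannian_metric A g'"
    and germ: "affine_germ (dual_connection \<Gamma> g) (dual_connection \<Gamma> g') f c0 d0 x"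
    and in0: "c0 \<in> A" "d0 \<in> A" "x \<in> fst c0" "f x \<in> fst d0"
    and in1: "c \<in> A" "d \<in> A" "x \<in> fst c" "f x \<in> fst d"
  shows "affine_germ (dual_connection \<Gamma> g) (dual_connection \<Gamma> g') f c d x"
proof -
  have ch: "is_chart c" "is_chart d" "is_chart c0" "is_chart d0"
    using smooth_structure_chart[OF A] in0 in1 by auto
  have "affine_germ (dual_connection \<Gamma> g) (dual_connection \<Gamma> g) id c c0 x"
    by (rule affine_germ_id[OF A dual_connection_transform[OF A \<Gamma> g(1)]]) (use in0 in1 in auto)
  moreover have "affine_germ (dual_connection \<Gamma> g') (dual_connection \<Gamma> g') id d0 d (f x)"
    by (rule affine_germ_id[OF A dual_connection_transform[OF A \<Gamma> g(2)]]) (use in0 in1 in auto)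
  ultimately have "affine_germ (dual_connection \<Gamma> g) (dual_connection \<Gamma> g') (id \<circ> (f \<circ> id)) c d x"
    using germ ch in0 in1
    by (intro affine_germ_compose[where d = d0] affine_germ_compose[where d = c0]) auto
  then show ?thesis by simp
qed

section \<open>Gradient maps along a segment of Hessian metrics\<close>

lemma pd_zero_constant:
  assumes "convex B" "\<And>y. y \<in> B \<Longrightarrow> f differentiable (at y)" "\<And>y i. y \<in> B \<Longrightarrow> pd i f y = 0"
    and "x \<in> B" "y \<in> B"
  shows "f x = f y"
proof -
  have "(f has_derivative (\<lambda>h. 0)) (at z within B)" if "z \<in> B" for z
    using has_derivative_pd[OF assms(2)[OF that]] assms(3)[OF that]
    by (simp add: has_derivative_at_withinI)
  from has_derivative_zero_constant[OF assms(1) this] show ?thesis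
    using assms(4,5) by metis
qed

locale hessian_segment =
  fixes A :: "('a::{t2_space,second_countable_topology}, 'n::finite) chart set"
    and \<Gamma> :: "('a, 'n) connection" and g g' :: "('a, 'n) metric" and \<phi> :: "'a \<Rightarrow> real"
  assumes A: "smooth_structure A" and \<Gamma>: "is_connection A \<Gamma>"
    and g: "riemannian_metric A g" and g': "riemannian_metric A g'"
    and \<phi>: "smooth_function A \<phi>"
    and diff: "\<And>c y. c \<in> A \<Longrightarrow> y \<in> chart_image c \<Longrightarrow> g c y - g' c y = cov_hessian \<Gamma> \<phi> c y"
begin

definition gt :: "real \<Rightarrow> ('a, 'n) metric"
  where "gt t c y = (1 - t) *\<^sub>R g c y + t *\<^sub>R g' c y"

lemmas chart = smooth_structure_chart[OF A]

lemma riemannian_gt: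
  assumes "t \<in> {0..1}"
  shows "riemannian_metric A (gt t)"
  unfolding riemannian_metric_def
proof (intro conjI ballI allI impI)
  fix c assume c: "c \<in> A"
  show "smooth_on (chart_image c) (gt t c)"
    unfolding gt_def[abs_def]
    by (intro smooth_on_add smooth_on_scaleR chart_open(2)[OF chart[OF c]]
        riemannian_metric_smooth[OF g c] riemannian_metric_smooth[OF g' c])
  fix y assume y: "y \<in> chart_image c"
  show "transpose (gt t c y) = gt t c y"
    using riemannian_metric_sym[OF g c y] riemannian_metric_sym[OF g' c y]
    by (simp add: gt_def transpose_def vec_eq_iff)
  fix v :: "real ^ 'n" assume v: "v \<noteq> 0"
  have "gt t c y *v v = (1 - t) *\<^sub>R (g c y *v v) + t *\<^sub>R (g' c y *v v)"
    by (simp add: gt_def matrix_vector_mult_add_rdistrib scaleR_matrix_vector_assoc)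
  then have "v \<bullet> (gt t c y *v v) = (1 - t) * (v \<bullet> (g c y *v v)) + t * (v \<bullet> (g' c y *v v))"
    by (simp add: inner_add_right)
  moreover have "v \<bullet> (g c y *v v) > 0" "v \<bullet> (g' c y *v v) > 0"
    using riemannian_metric_pos[OF g c y v] riemannian_metric_pos[OF g' c y v] by auto
  \<comment> \<open>At \<open>t = 0\<close> strictness comes from \<open>g\<close>, otherwise from
    \<open>g'\<close>.\<close>
  ultimately show "v \<bullet> (gt t c y *v v) > 0"
    using assms by (cases "t = 0") (auto intro!: add_nonneg_pos)
next
  fix c d y i j assume cd: "c \<in> A" "d \<in> A" "y \<in> local_dom c d id"
  show "gt t c y $ i $ j = (\<Sum>a\<in>UNIV. \<Sum>b\<in>UNIV. gt t d (local_rep c d id y) $ a $ b *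
        pd i (local_rep c d id) y $ a * pd j (local_rep c d id) y $ b)"
    using riemannian_metric_change[OF g cd, of i j] riemannian_metric_change[OF g' cd, of i j]
    by (simp add: gt_def sum_distrib_left sum.distrib distrib_right mult.assoc)
qed

text \<open>\<open>P\<close> is the gradient of a potential of \<open>g\<close>.\<close>

definition gradient_chart :: "('a, 'n) chart \<Rightarrow> (real ^ 'n \<Rightarrow> real ^ 'n) \<Rightarrow> bool"
  where "gradient_chart c P \<longleftrightarrow> affine_chart A \<Gamma> c \<and> convex (chart_image c) \<and>
    smooth_on (chart_image c) P \<and> (\<forall>y\<in>chart_image c. \<forall>j k. pd j P y $ k = g c y $ j $ k)"

definition d\<phi> :: "('a, 'n) chart \<Rightarrow> real ^ 'n \<Rightarrow> real ^ 'n"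
  where "d\<phi> c y = (\<chi> k. pd k (\<lambda>z. \<phi> (chart_inv c z)) y)"

definition F :: "('a, 'n) chart \<Rightarrow> (real ^ 'n \<Rightarrow> real ^ 'n) \<Rightarrow> real \<Rightarrow> real ^ 'n \<Rightarrow> real ^ 'n"
  where "F c P t y = P y - t *\<^sub>R d\<phi> c y"

lemma gradient_chartD:
  assumes "gradient_chart c P"
  shows "c \<in> A" "\<And>y. y \<in> chart_image c \<Longrightarrow> \<Gamma> c y = 0" "convex (chart_image c)"
    "smooth_on (chart_image c) P" "\<And>y j k. y \<in> chart_image c \<Longrightarrow> pd j P y $ k = g c y $ j $ k"
    "is_chart c" "open (chart_image c)"
  using assms chart chart_open(2) unfolding gradient_chart_def affine_chart_def by blast+

lemma gradient_chart_exists: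
  assumes "hessian_metric A \<Gamma> g"
  obtains c P where "gradient_chart c P" "p \<in> fst c"
proof -
  obtain c \<psi> where c: "affine_chart A \<Gamma> c" "p \<in> fst c" "convex (chart_image c)"
    "smooth_on (chart_image c) \<psi>" "\<And>y j k. y \<in> chart_image c \<Longrightarrow> g c y $ j $ k = pd j (pd k \<psi>) y"
    using assms[unfolded hessian_metric_def, THEN conjunct2, THEN spec, of p] by blast
  have o: "open (chart_image c)" using c(1) chart chart_open(2) unfolding affine_chart_def by blast
  define P where "P y = (\<chi> k. pd k \<psi> y)" for y
  have P: "smooth_on (chart_image c) P"
    by (rule smooth_on_vec[OF o]) (simp add: P_def smooth_on_pd[OF c(4)])
  have "pd j P y $ k = g c y $ j $ k" if "y \<in> chart_image c" for y j k
    using pd_nth[OF smooth_on_differentiable[OF P that], of j k] c(5)[OF that] by (simp add: P_def)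
  then show ?thesis using that[of c P] c P by (simp add: gradient_chart_def)
qed

lemma smooth_d\<phi>:
  assumes "c \<in> A"
  shows "smooth_on (chart_image c) (d\<phi> c)"
proof (rule smooth_on_vec[OF chart_open(2)[OF chart[OF assms]]])
  have "smooth_on (chart_image c) (\<lambda>z. \<phi> (chart_inv c z))"
    using \<phi> assms unfolding smooth_function_def by blast
  then show "smooth_on (chart_image c) (\<lambda>y. d\<phi> c y $ i)" for i
    by (simp add: d\<phi>_def smooth_on_pd)
qed

lemma smooth_F:
  assumes "gradient_chart c P"
  shows "smooth_on (chart_image c) (F c P t)"
  unfolding F_def[abs_def]
  by (intro smooth_on_diff smooth_on_scaleR gradient_chartD(7,4)[OF assms] smooth_d\<phi> gradient_chartD(1)[OF assms])

text \<open>The chart is affine, so the Christoffel term of \<open>cov_hessian\<close> vanishes and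
  the Jacobian of \<open>d\<phi>\<close> is \<open>g - g'\<close>. Subtracting \<open>t\<close>
  times this from \<open>g\<close> gives \<open>gt t\<close>.\<close>

lemma pd_F:
  assumes c: "gradient_chart c P" and y: "y \<in> chart_image c"
  shows "pd j (F c P t) y $ k = gt t c y $ j $ k"
proof -
  note cA = gradient_chartD(1)[OF c]
  have d: "d\<phi> c differentiable (at y)" "P differentiable (at y)"
    using smooth_on_differentiable[OF smooth_d\<phi>[OF cA] y]
      smooth_on_differentiable[OF gradient_chartD(4)[OF c] y] by auto
  have "(\<lambda>z. t *\<^sub>R d\<phi> c z) differentiable (at y)"
    using smooth_on_differentiable[OF smooth_on_scaleR[OF gradient_chartD(7)[OF c] smooth_d\<phi>[OF cA]] y] .
  then have "pd j (F c P t) y = pd j P y - t *\<^sub>R pd j (d\<phi> c) y"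
    unfolding F_def[abs_def] using d by (simp add: pd_diff pd_scaleR)
  moreover have "pd j (d\<phi> c) y $ k = pd j (pd k (\<lambda>z. \<phi> (chart_inv c z))) y"
    using pd_nth[OF d(1), of j k] by (simp add: d\<phi>_def)
  moreover have "g c y $ j $ k - g' c y $ j $ k = pd j (pd k (\<lambda>z. \<phi> (chart_inv c z))) y"
    using diff[OF cA y] gradient_chartD(2)[OF c y] by (simp add: cov_hessian_def vec_eq_iff)
  ultimately have "pd j (F c P t) y $ k = g c y $ j $ k - t * (g c y $ j $ k - g' c y $ j $ k)"
    using gradient_chartD(5)[OF c y, of j k] by simp
  then show ?thesis by (simp add: gt_def algebra_simps)
qed

lemma derivative_F:
  assumes c: "gradient_chart c P" and y: "y \<in> chart_image c" and t: "t \<in> {0..1}"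
  shows "(\<Sum>i\<in>UNIV. (v $ i) *\<^sub>R pd i (F c P t) y) = gt t c y *v v"
proof -
  have "gt t c y $ k $ i = gt t c y $ i $ k" for i k
    using arg_cong[OF riemannian_metric_sym[OF riemannian_gt[OF t] gradient_chartD(1)[OF c] y], of "\<lambda>M. M $ i $ k"]
    by (simp add: transpose_def)
  then show ?thesis
    by (simp add: vec_eq_iff matrix_vector_mult_def pd_F[OF c y] mult.commute)
qed

lemma gt_pos:
  assumes c: "gradient_chart c P" and y: "y \<in> chart_image c" and t: "t \<in> {0..1}" and "v \<noteq> 0"
  shows "v \<bullet> (gt t c y *v v) > 0"
  by (rule riemannian_metric_pos[OF riemannian_gt[OF t] gradient_chartD(1)[OF c] y assms(4)])

lemma derivative_F_kernel:
  assumes c: "gradient_chart c P" and y: "y \<in> chart_image c" and t: "t \<in> {0..1}"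
    and v: "(\<Sum>i\<in>UNIV. (v $ i) *\<^sub>R pd i (F c P t) y) = 0"
  shows "v = 0"
  using gt_pos[OF c y t, of v] v by (auto simp: derivative_F[OF c y t])

lemma inj_F:
  assumes c: "gradient_chart c P" and t: "t \<in> {0..1}"
  shows "inj_on (F c P t) (chart_image c)"
  by (rule inj_on_positive_derivative[OF gradient_chartD(3)[OF c] smooth_on_differentiable[OF smooth_F[OF c]]])
    (simp_all add: derivative_F[OF c _ t] gt_pos[OF c _ t])

text \<open>The derivatives of \<open>gt t\<close> are second derivatives of its gradient map, hence
  symmetric in all three indices (\<open>D1\<close> to \<open>D3\<close>). In the lowered
  Levi-Civita symbol two of the three terms cancel, the factor 2 of the dual connection cancels the
  1/2, and what remains is the second derivative of \<open>F c P t\<close>, as required for the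
  target symbol 0.\<close>

lemma christoffel_transform_F:
  assumes c: "gradient_chart c P" and y: "y \<in> chart_image c" and t: "t \<in> {0..1}"
  shows "christoffel_transform (F c P t) y (dual_connection \<Gamma> (gt t) c y) 0"
proof -
  note cA = gradient_chartD(1)[OF c] and o = gradient_chartD(7)[OF c]
  note R = riemannian_gt[OF t]
  have sym: "gt t c z $ i $ j = gt t c z $ j $ i" if "z \<in> chart_image c" for z i j
    using arg_cong[OF riemannian_metric_sym[OF R cA that], of "\<lambda>M. M $ j $ i"] by (simp add: transpose_def)
  note dg = smooth_on_differentiable[OF riemannian_metric_smooth[OF R cA] y]
  note sp = smooth_on_pd[OF smooth_F[OF c]]
  have D1: "pd l (gt t c) y $ i $ j = pd l (pd i (F c P t)) y $ j" for l i j
  proof -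
    have "pd l (\<lambda>z. gt t c z $ i $ j) y = pd l (\<lambda>z. pd i (F c P t) z $ j) y"
      by (rule pd_cong[OF o y]) (simp_all add: pd_F[OF c] smooth_on_differentiable[OF smooth_on_nth[OF o sp] y])
    then show ?thesis
      using pd_nth_nth[OF dg] pd_nth[OF smooth_on_differentiable[OF sp y]] by metis
  qed
  have D2: "pd l (gt t c) y $ i $ j = pd l (gt t c) y $ j $ i" for l i j
  proof -
    have "pd l (\<lambda>z. gt t c z $ i $ j) y = pd l (\<lambda>z. gt t c z $ j $ i) y"
      by (rule pd_cong[OF o y sym])
        (simp_all add: smooth_on_differentiable[OF smooth_on_nth[OF o smooth_on_nth[OF o riemannian_metric_smooth[OF R cA]]] y])
    then show ?thesis by (simp only: pd_nth_nth[OF dg])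
  qed
  have D3: "pd l (gt t c) y $ i $ j = pd i (gt t c) y $ l $ j" for l i j
    unfolding D1 by (simp add: pd_commute[OF o y smooth_F[OF c], of l i])
  show ?thesis
    unfolding christoffel_transform_def
  proof (intro allI)
    fix i j k
    have "(\<Sum>m\<in>UNIV. dual_connection \<Gamma> (gt t) c y $ m $ i $ j * pd m (F c P t) y $ k) =
        2 * (\<Sum>m\<in>UNIV. gt t c y $ k $ m * levi_civita (gt t) c y $ m $ i $ j)"
      by (simp add: dual_connection_def gradient_chartD(2)[OF c y] pd_F[OF c y] sym[OF y, of _ k]
          sum_distrib_left mult_ac)
    also have "(\<Sum>m\<in>UNIV. gt t c y $ k $ m * levi_civita (gt t) c y $ m $ i $ j) =
        (1 / 2) * (pd i (gt t c) y $ j $ k + pd j (gt t c) y $ i $ k - pd k (gt t c) y $ i $ j)"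
      by (rule levi_civita_lower) (rule gt_pos[OF c y t])
    also have "pd j (gt t c) y $ i $ k = pd k (gt t c) y $ i $ j"
      using D2[of j i k] D3[of j k i] D2[of k j i] by simp
    finally show "(\<Sum>m\<in>UNIV. dual_connection \<Gamma> (gt t) c y $ m $ i $ j * pd m (F c P t) y $ k) =
      pd i (pd j (F c P t)) y $ k +
      (\<Sum>a\<in>UNIV. \<Sum>b\<in>UNIV. (0 :: real ^ 'n ^ 'n ^ 'n) $ k $ a $ b * pd i (F c P t) y $ a * pd j (F c P t) y $ b)"
      by (simp add: D1)
  qed
qed

text \<open>Between affine charts the transition \<open>T\<close> has vanishing second derivatives,
  so its Jacobian \<open>J\<close> is locally constant. Then \<open>P\<close> and \<open>J\<close>
  applied to \<open>Q\<close> after \<open>T\<close> have the same derivative, namely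
  \<open>g\<close>, and differ by a constant, which drops out of differences of values of
  \<open>F\<close>. Only the relation is exported, since it mentions neither \<open>J\<close> nor
  the constant.\<close>

lemma gradient_charts_compatible:
  assumes c: "gradient_chart c P" and d: "gradient_chart d Q" and x0: "x0 \<in> fst c" "x0 \<in> fst d"
  obtains U where "open U" "x0 \<in> U" "U \<subseteq> fst c \<inter> fst d"
    "\<And>x y s t. x \<in> U \<Longrightarrow> y \<in> U \<Longrightarrow>
      F c P s (snd c y) = F c P t (snd c x) \<longleftrightarrow> F d Q s (snd d y) = F d Q t (snd d x)"
proof -
  note cA = gradient_chartD(1)[OF c] and dA = gradient_chartD(1)[OF d]
    and cc = gradient_chartD(6)[OF c] and cd = gradient_chartD(6)[OF d]
  define T where "T = local_rep c d id"
  define W where "W = local_dom c d id"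
  have W: "open W" unfolding W_def by (rule open_local_dom[OF cc cd]) simp
  have T: "smooth_on W T" unfolding T_def W_def by (rule smooth_structure_transition[OF A cA dA])
  have inW: "z \<in> W \<longleftrightarrow> z \<in> chart_image c \<and> chart_inv c z \<in> fst d" for z
    unfolding W_def mem_local_dom[OF cc] by simp
  have Tim: "T z \<in> chart_image d" "chart_inv d (T z) = chart_inv c z" if "z \<in> W" for z
    using that chart_in_image[OF cd] chart_inv_chart[OF cd] by (auto simp: T_def local_rep_def inW)
  have TW: "T ` W \<subseteq> chart_image d" using Tim by blast
  have od: "open (chart_image d)" by (rule gradient_chartD(7)[OF d])
  have TT: "pd i (pd j T) z = 0" if z: "z \<in> W" for i j z
  proof -
    have "christoffel_transform T z (\<Gamma> c z) (\<Gamma> d (T z))"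
      using \<Gamma> cA dA z unfolding is_connection_def T_def W_def by blast
    moreover have "\<Gamma> c z = 0" "\<Gamma> d (T z) = 0"
      using z Tim(1)[OF z] gradient_chartD(2)[OF c] gradient_chartD(2)[OF d] by (auto simp: inW)
    ultimately show ?thesis by (simp add: christoffel_transform_def vec_eq_iff)
  qed
  have x0W: "snd c x0 \<in> W"
    using x0 chart_in_image[OF cc] chart_inv_chart[OF cc] by (simp add: inW)
  \<comment> \<open>A ball, because constancy follows from a vanishing derivative on a convex set,
    while \<open>W\<close> may be disconnected.\<close>
  obtain r where r: "r > 0" "ball (snd c x0) r \<subseteq> W"
    using W x0W open_contains_ball by blast
  define B where "B = ball (snd c x0) r"
  have B: "open B" "convex B" "B \<subseteq> W" "snd c x0 \<in> B" using r by (auto simp: B_def)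
  define J where "J i a = pd i T (snd c x0) $ a" for i a
  have pT: "pd i T z $ a = J i a" if "z \<in> B" for z i a
    unfolding J_def
    using pd_zero_constant[OF B(2), of "pd i T" z "snd c x0"] that B
      smooth_on_differentiable[OF smooth_on_pd[OF T]] TT by (auto simp: subset_iff)
  have dT: "T differentiable (at z)" if "z \<in> W" for z
    by (rule smooth_on_differentiable[OF T that])
  have sQT: "smooth_on W (\<lambda>z. Q (T z) $ a)" for a
    by (intro smooth_on_nth[OF W] smooth_on_compose[OF W od gradient_chartD(4)[OF d] T TW])
  have sJ: "smooth_on W (\<lambda>z. \<Sum>a\<in>UNIV. J i a * Q (T z) $ a)" for i
    by (intro smooth_on_sum smooth_on_mult smooth_on_const W sQT)
  have sP: "smooth_on W (\<lambda>z. P z $ i)" for i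
    by (rule smooth_on_nth[OF W smooth_on_subset[OF gradient_chartD(4)[OF c]]]) (auto simp: inW)
  have K: "P w $ i - (\<Sum>a\<in>UNIV. J i a * Q (T w) $ a) = P z $ i - (\<Sum>a\<in>UNIV. J i a * Q (T z) $ a)"
    if "w \<in> B" "z \<in> B" for w z i
  proof (rule pd_zero_constant[OF B(2) _ _ that])
    show "(\<lambda>w. P w $ i - (\<Sum>a\<in>UNIV. J i a * Q (T w) $ a)) differentiable (at y)" if "y \<in> B" for y
      using smooth_on_differentiable[OF smooth_on_diff[OF W sP sJ]] that B(3) by blast
    fix y j assume y: "y \<in> B"
    then have yW: "y \<in> W" and yc: "y \<in> chart_image c" using B(3) inW by auto
    have "pd j (\<lambda>w. \<Sum>a\<in>UNIV. J i a * Q (T w) $ a) y = (\<Sum>a\<in>UNIV. pd j (\<lambda>w. J i a * Q (T w) $ a) y)"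
      by (rule pd_sum) (auto intro!: smooth_on_differentiable[OF _ yW] smooth_on_mult smooth_on_const W sQT)
    also have "\<dots> = (\<Sum>a\<in>UNIV. J i a * (\<Sum>b\<in>UNIV. J j b * g d (T y) $ b $ a))"
    proof (rule sum.cong[OF refl])
      fix a
      have dQ: "Q differentiable (at (T y))"
        by (rule smooth_on_differentiable[OF gradient_chartD(4)[OF d] Tim(1)[OF yW]])
      have "pd j (\<lambda>w. Q (T w) $ a) y = (\<Sum>b\<in>UNIV. pd j T y $ b * pd b (\<lambda>u. Q u $ a) (T y))"
        using pd_compose[OF dT[OF yW] smooth_on_differentiable[OF smooth_on_nth[OF od gradient_chartD(4)[OF d]] Tim(1)[OF yW]], of j a]
        by simp
      also have "\<dots> = (\<Sum>b\<in>UNIV. J j b * g d (T y) $ b $ a)"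
        by (simp add: pd_nth[OF dQ] gradient_chartD(5)[OF d Tim(1)[OF yW]] pT[OF y])
      finally show "pd j (\<lambda>w. J i a * Q (T w) $ a) y = J i a * (\<Sum>b\<in>UNIV. J j b * g d (T y) $ b $ a)"
        using pd_scaleR[OF smooth_on_differentiable[OF sQT yW], of j "J i a" a] by simp
    qed
    also have "\<dots> = (\<Sum>b\<in>UNIV. \<Sum>a\<in>UNIV. g d (T y) $ b $ a * J j b * J i a)"
      by (simp only: sum_distrib_left, subst sum.swap) (simp only: mult_ac)
    also have "\<dots> = g c y $ j $ i"
      using riemannian_metric_change[OF g cA dA, of y j i] yW pT[OF y] by (simp add: T_def W_def)
    also have "\<dots> = pd j (\<lambda>w. P w $ i) y"
      using pd_nth[OF smooth_on_differentiable[OF gradient_chartD(4)[OF c] yc]] gradient_chartD(5)[OF c yc] by simp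
    finally show "pd j (\<lambda>w. P w $ i - (\<Sum>a\<in>UNIV. J i a * Q (T w) $ a)) y = 0"
      using pd_diff[OF smooth_on_differentiable[OF sP yW] smooth_on_differentiable[OF sJ yW]] by simp
  qed
  \<comment> \<open>No additive constant appears here, in contrast to \<open>K\<close>; so the
    translation between the two gradient maps is the same for every parameter.\<close>
  have Kphi: "d\<phi> c z $ i = (\<Sum>a\<in>UNIV. J i a * d\<phi> d (T z) $ a)" if z: "z \<in> B" for z i
  proof -
    have zW: "z \<in> W" using z B by auto
    have s: "smooth_on (chart_image d) (\<lambda>u. \<phi> (chart_inv d u))"
      using \<phi> dA unfolding smooth_function_def by blast
    have "pd i (\<lambda>w. \<phi> (chart_inv c w)) z = pd i (\<lambda>w. \<phi> (chart_inv d (T w))) z"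
      by (rule pd_cong[OF W zW])
        (simp_all add: Tim smooth_on_differentiable[OF smooth_on_compose[OF W od s T TW] zW])
    also have "\<dots> = (\<Sum>a\<in>UNIV. J i a * pd a (\<lambda>u. \<phi> (chart_inv d u)) (T z))"
      using pd_compose[OF dT[OF zW] smooth_on_differentiable[OF s Tim(1)[OF zW]], of i] pT[OF z] by simp
    finally show ?thesis by (simp add: d\<phi>_def)
  qed
  have main: "F c P s w $ i - F c P t z $ i = (\<Sum>a\<in>UNIV. J i a * (F d Q s (T w) - F d Q t (T z)) $ a)"
    if "w \<in> B" "z \<in> B" for s t w z i
    using K[OF that, of i] Kphi[OF that(1), of i] Kphi[OF that(2), of i]
    by (simp add: F_def right_diff_distrib sum_subtractf sum_distrib_left mult_ac)
  have ker: "v = 0" if "\<And>i. (\<Sum>a\<in>UNIV. J i a * v $ a) = 0" for v :: "real ^ 'n"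
  proof (rule congruence_kernel[where M = "g c (snd c x0)" and M' = "g d (T (snd c x0))" and P = J])
    show "u \<bullet> (g c (snd c x0) *v u) > 0" if "u \<noteq> 0" for u
      using riemannian_metric_pos[OF g cA _ that] x0W inW by blast
    show "g c (snd c x0) $ i $ j = (\<Sum>a\<in>UNIV. \<Sum>b\<in>UNIV. g d (T (snd c x0)) $ a $ b * J i a * J j b)" for i j
      using riemannian_metric_change[OF g cA dA, of "snd c x0" i j] x0W by (simp add: T_def W_def J_def)
  qed (rule that)
  define U where "U = fst c \<inter> snd c -` B"
  have Ud: "T (snd c x) = snd d x" "x \<in> fst d" "snd c x \<in> B" if "x \<in> U" for x
    using that B(3) by (auto simp: U_def T_def local_rep_chart[OF cc] inW chart_inv_chart[OF cc] subset_iff)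
  show ?thesis
  proof (rule that[of U])
    show "open U" unfolding U_def by (rule open_chart_preimage[OF cc B(1)])
    show "x0 \<in> U" using x0 B by (simp add: U_def)
    show "U \<subseteq> fst c \<inter> fst d" using Ud(2) by (auto simp: U_def)
    fix x y s t assume xy: "x \<in> U" "y \<in> U"
    note m = main[OF Ud(3)[OF xy(2)] Ud(3)[OF xy(1)], of s _ t, unfolded Ud(1)[OF xy(1)] Ud(1)[OF xy(2)]]
    show "F c P s (snd c y) = F c P t (snd c x) \<longleftrightarrow> F d Q s (snd d y) = F d Q t (snd d x)"
    proof
      assume "F c P s (snd c y) = F c P t (snd c x)"
      then have "(\<Sum>a\<in>UNIV. J i a * (F d Q s (snd d y) - F d Q t (snd d x)) $ a) = 0" for i
        using m[of i] by simp
      from ker[OF this] show "F d Q s (snd d y) = F d Q t (snd d x)" by simp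
    next
      assume "F d Q s (snd d y) = F d Q t (snd d x)"
      then show "F c P s (snd c y) = F c P t (snd c x)"
        using m by (simp add: vec_eq_iff)
    qed
  qed
qed

section \<open>From local to global\<close>

text \<open>The solution is found inside a prescribed \<open>U\<close>, so that \<open>x\<close> and
  \<open>y\<close> both lie where the other gradient charts are known to give the same
  relation.\<close>

lemma gradient_chart_solvable:
  assumes c: "gradient_chart c P" and U: "open U" "x0 \<in> U" "U \<subseteq> fst c" and s0: "s0 \<in> {0..1}"
  obtains \<delta> N where "\<delta> > 0" "open N" "x0 \<in> N" "N \<subseteq> U"
    "\<And>s t x. s \<in> {0..1} \<Longrightarrow> t \<in> {0..1} \<Longrightarrow> \<bar>s - s0\<bar> < \<delta> \<Longrightarrow> \<bar>t - s0\<bar> < \<delta> \<Longrightarrow> x \<in> N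
      \<Longrightarrow> \<exists>y\<in>U. F c P s (snd c y) = F c P t (snd c x)"
proof -
  note cA = gradient_chartD(1)[OF c] and cc = gradient_chartD(6)[OF c]
  define V where "V = snd c ` U"
  have V: "open V" unfolding V_def by (rule open_chart_image_of[OF cc U(1,3)])
  have Vc: "V \<subseteq> chart_image c" using U(3) chart_in_image[OF cc] by (auto simp: V_def)
  have cP: "continuous_on V P" "continuous_on V (d\<phi> c)"
    using smooth_on_continuous_on[OF gradient_chartD(4)[OF c]] smooth_on_continuous_on[OF smooth_d\<phi>[OF cA]]
      Vc continuous_on_subset by blast+
  have "continuous_on ({0..1} \<times> V) (\<lambda>p. P (snd p) - fst p *\<^sub>R d\<phi> c (snd p))"
    by (intro continuous_intros continuous_on_compose2[OF cP(1)] continuous_on_compose2[OF cP(2)]) auto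
  then have cont: "continuous_on ({0..1} \<times> V) (\<lambda>(s, y). F c P s y)"
    by (simp add: F_def case_prod_unfold)
  have inj: "inj_on (F c P s) V" if "0 \<le> s" "s \<le> 1" for s
    using inj_on_subset[OF inj_F[OF c] Vc] that by simp
  have s01: "0 \<le> s0" "s0 \<le> 1" using s0 by auto
  have x0V: "snd c x0 \<in> V" using U by (simp add: V_def)
  obtain \<delta> N where N: "\<delta> > 0" "open N" "snd c x0 \<in> N" "N \<subseteq> V"
    "\<And>s t x. s \<in> {0..1} \<Longrightarrow> t \<in> {0..1} \<Longrightarrow> \<bar>s - s0\<bar> < \<delta> \<Longrightarrow> \<bar>t - s0\<bar> < \<delta> \<Longrightarrow> x \<in> N
      \<Longrightarrow> \<exists>y\<in>V. F c P s y = F c P t x"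
    using family_solvable_nearby[OF cont inj s01 V x0V] by blast
  show ?thesis
  proof (rule that[OF N(1)])
    show "open (fst c \<inter> snd c -` N)" by (rule open_chart_preimage[OF cc N(2)])
    show "x0 \<in> fst c \<inter> snd c -` N" using U N by auto
    show "fst c \<inter> snd c -` N \<subseteq> U"
    proof
      fix x assume x: "x \<in> fst c \<inter> snd c -` N"
      then obtain u where "u \<in> U" "snd c x = snd c u" using N(4) by (auto simp: V_def)
      then show "x \<in> U" using x U(3) chart_inv_chart[OF cc] by (metis IntD1 subsetD)
    qed
    fix s t x assume "s \<in> {0..1}" "t \<in> {0..1}" "\<bar>s - s0\<bar> < \<delta>" "\<bar>t - s0\<bar> < \<delta>" "x \<in> fst c \<inter> snd c -` N"
    then show "\<exists>y\<in>U. F c P s (snd c y) = F c P t (snd c x)"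
      using N(5)[of s t "snd c x"] by (auto simp: V_def)
  qed
qed

text \<open>No regularity of \<open>f\<close> is assumed: as \<open>F c P s\<close> is injective,
  the matching equation forces \<open>f\<close> to be its inverse after \<open>F c P t\<close> in
  coordinates, which is smooth. Both gradient maps lead to the zero connection, so cancelling the
  outer one shows that \<open>f\<close> carries one dual to the other.\<close>

lemma gradient_matching_germ:
  assumes c: "gradient_chart c P" and V: "open V" "V \<subseteq> fst c"
    and f: "\<And>z. z \<in> V \<Longrightarrow> f z \<in> fst c \<and> F c P s (snd c (f z)) = F c P t (snd c z)"
    and st: "s \<in> {0..1}" "t \<in> {0..1}"
  shows "continuous_on V f"
    and "x \<in> V \<Longrightarrow> affine_germ (dual_connection \<Gamma> (gt t)) (dual_connection \<Gamma> (gt s)) f c c x"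
proof -
  note cA = gradient_chartD(1)[OF c] and cc = gradient_chartD(6)[OF c] and o = gradient_chartD(7)[OF c]
  define W where "W = snd c ` V"
  have W: "open W" unfolding W_def by (rule open_chart_image_of[OF cc V])
  have Wc: "W \<subseteq> chart_image c" using V(2) chart_in_image[OF cc] by (auto simp: W_def)
  have inV: "chart_inv c y \<in> V" "snd c (chart_inv c y) = y" if "y \<in> W" for y
    using that V(2) chart_inv_chart[OF cc] by (auto simp: W_def subset_iff)
  let ?f = "local_rep c c f"
  have fW: "?f y \<in> chart_image c" "F c P s (?f y) = F c P t y" if "y \<in> W" for y
    using f[OF inV(1)[OF that]] chart_in_image[OF cc] inV(2)[OF that] by (auto simp: local_rep_def)
  have Wdom: "W \<subseteq> local_dom c c f"
    using f inV Wc by (auto simp: mem_local_dom[OF cc])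
  define G where "G = inv_into (chart_image c) (F c P s)"
  have GF: "G (F c P s y) = y" if "y \<in> chart_image c" for y
    unfolding G_def by (rule inv_into_f_f[OF inj_F[OF c st(1)] that])
  note G = smooth_on_inverse_function[OF o smooth_F[OF c] GF derivative_F_kernel[OF c _ st(1)]]
  have sFt: "smooth_on W (F c P t)" by (rule smooth_on_subset[OF smooth_F[OF c] Wc])
  have "F c P t ` W \<subseteq> F c P s ` chart_image c"
  proof (rule image_subsetI)
    fix y assume "y \<in> W"
    from fW[OF this] show "F c P t y \<in> F c P s ` chart_image c" by (metis image_eqI)
  qed
  then have "smooth_on W (\<lambda>y. G (F c P t y))"
    by (intro smooth_on_compose[OF W G(1) G(2) sFt])
  moreover have fG: "?f y = G (F c P t y)" if "y \<in> W" for y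
    using GF[OF fW(1)[OF that]] fW(2)[OF that] by simp
  ultimately have sf: "smooth_on W ?f"
    using smooth_on_cong[OF W, of ?f "\<lambda>y. G (F c P t y)"] by simp
  have ct: "christoffel_transform ?f y (dual_connection \<Gamma> (gt t) c y) (dual_connection \<Gamma> (gt s) c (?f y))"
    if y: "y \<in> W" for y
  proof (rule christoffel_transform_cancel[OF W y sf o smooth_F[OF c]])
    show "?f ` W \<subseteq> chart_image c" using fW by blast
    have "christoffel_transform (F c P t) y (dual_connection \<Gamma> (gt t) c y) 0"
      using christoffel_transform_F[OF c _ st(2)] y Wc by blast
    then show "christoffel_transform (\<lambda>z. F c P s (?f z)) y (dual_connection \<Gamma> (gt t) c y) 0"
      using christoffel_transform_cong[OF W y _ sFt, of "\<lambda>z. F c P s (?f z)"] fW(2) by simp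
    show "christoffel_transform (F c P s) (?f y) (dual_connection \<Gamma> (gt s) c (?f y)) 0"
      by (rule christoffel_transform_F[OF c fW(1)[OF y] st(1)])
  qed (rule derivative_F_kernel[OF c fW(1)[OF y] st(1)])
  have fV: "f z = chart_inv c (?f (snd c z))" if "z \<in> V" for z
    using that V(2) f[OF that] by (simp add: local_rep_chart[OF cc] chart_inv_chart[OF cc] subset_iff)
  have "continuous_on V (\<lambda>z. chart_inv c (?f (snd c z)))"
  proof (rule continuous_on_compose2[OF chart_continuous(2)[OF cc]])
    show "continuous_on V (\<lambda>z. ?f (snd c z))"
      by (rule continuous_on_compose2[OF smooth_on_continuous_on[OF sf] continuous_on_subset[OF chart_continuous(1)[OF cc] V(2)]])
        (auto simp: W_def)
    show "(\<lambda>z. ?f (snd c z)) ` V \<subseteq> chart_image c" using fW by (auto simp: W_def)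
  qed
  then show "continuous_on V f" using fV by (simp cong: continuous_on_cong)
  show "affine_germ (dual_connection \<Gamma> (gt t)) (dual_connection \<Gamma> (gt s)) f c c x" if x: "x \<in> V"
  proof -
    have "snd c x \<in> W" using x by (simp add: W_def)
    moreover have "?f (snd c x) = snd c (f x)" using x V(2) by (simp add: local_rep_chart[OF cc] subset_iff)
    ultimately show ?thesis
      unfolding affine_germ_def using W Wdom sf ct[of "snd c x"] by auto
  qed
qed

text \<open>\<open>K\<close> is the image of a closed ball, hence compact and closed in a Hausdorff
  space. Closedness lets a point outside \<open>K\<close> have a neighbourhood that avoids
  \<open>K\<close>.\<close>

lemma gradient_chart_patch:
  assumes "hessian_metric A \<Gamma> g"
  shows "\<exists>c P V K. gradient_chart c P \<and> open V \<and> p \<in> V \<and> V \<subseteq> K \<and> closed K \<and> K \<subseteq> fst c"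
proof -
  obtain c P where c: "gradient_chart c P" "p \<in> fst c" by (rule gradient_chart_exists[OF assms])
  note cc = gradient_chartD(6)[OF c(1)] and o = gradient_chartD(7)[OF c(1)]
  obtain r where r: "r > 0" "cball (snd c p) r \<subseteq> chart_image c"
    using o chart_in_image[OF cc c(2)] open_contains_cball by blast
  define V where "V = fst c \<inter> snd c -` ball (snd c p) r"
  define K where "K = chart_inv c ` cball (snd c p) r"
  have "open V" unfolding V_def by (rule open_chart_preimage[OF cc open_ball])
  moreover have "p \<in> V" using c r by (simp add: V_def)
  moreover have "V \<subseteq> K"
  proof
    fix x assume "x \<in> V"
    then show "x \<in> K" unfolding V_def K_def
      by (intro image_eqI[where x = "snd c x"]) (auto simp: chart_inv_chart[OF cc])
  qed
  moreover have "closed K"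
    unfolding K_def
    by (intro compact_imp_closed compact_continuous_image compact_cball
        continuous_on_subset[OF chart_continuous(2)[OF cc] r(2)])
  moreover have "K \<subseteq> fst c" using r(2) chart_inv_in[OF cc] by (auto simp: K_def)
  ultimately show ?thesis using c(1) by blast
qed

lemma dual_locally_constant:
  assumes X: "compact (UNIV :: 'a set)" and H: "hessian_metric A \<Gamma> g" and s0: "s0 \<in> {0..1}"
  obtains \<delta> where "\<delta> > 0"
    "\<And>s t. s \<in> {0..1} \<Longrightarrow> t \<in> {0..1} \<Longrightarrow> \<bar>s - s0\<bar> < \<delta> \<Longrightarrow> \<bar>t - s0\<bar> < \<delta> \<Longrightarrow>
      affinely_equivalent A (dual_connection \<Gamma> (gt t)) (dual_connection \<Gamma> (gt s))"
proof -
  have "\<forall>p. \<exists>c P V K. gradient_chart c P \<and> open V \<and> p \<in> V \<and> V \<subseteq> K \<and> closed K \<and> K \<subseteq> fst c"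
    using gradient_chart_patch[OF H] by blast
  then obtain c P V K where patch: "\<And>p. gradient_chart (c p) (P p)" "\<And>p. open (V p)" "\<And>p :: 'a. p \<in> V p"
    "\<And>p. V p \<subseteq> K p" "\<And>p. closed (K p)" "\<And>p. K p \<subseteq> fst (c p)"
    by metis
  obtain I where I: "finite I" "(UNIV :: 'a set) \<subseteq> (\<Union>p\<in>I. V p)"
    using compactE_image[OF X, of UNIV V] patch(2,3) by (metis UNIV_I UN_iff subsetI)
  define E where "E p s t x y \<longleftrightarrow> F (c p) (P p) s (snd (c p) y) = F (c p) (P p) t (snd (c p) x)" for p s t x y
  \<comment> \<open>Patches \<open>V\<close> inside closed sets \<open>K\<close>: near \<open>x0\<close> only the finitely many charts with \<open>x0 \<in> K q\<close>
    matter, and any one of them decides the relation.\<close>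
  define rel where "rel s t x y \<longleftrightarrow> (\<forall>q\<in>I. x \<in> K q \<longrightarrow> y \<in> fst (c q) \<and> E q s t x y)" for s t x y
  \<comment> \<open>\<open>rel\<close> is not visibly symmetric, as it tests only the sets
    \<open>K q\<close> that contain its first point. Both directions are asked for because the
    second one identifies the inverse map.\<close>
  have loc: "\<exists>N \<delta>. open N \<and> x0 \<in> N \<and> \<delta> > 0 \<and> (\<forall>s\<in>{0..1}. \<forall>t\<in>{0..1}. \<bar>s - s0\<bar> < \<delta> \<longrightarrow> \<bar>t - s0\<bar> < \<delta> \<longrightarrow>
      (\<forall>x\<in>N. \<exists>y. rel s t x y \<and> rel t s y x))" for x0
  proof -
    have "\<exists>U. open U \<and> x0 \<in> U \<and> (x0 \<notin> K p \<longrightarrow> U \<inter> K p = {}) \<and> (x0 \<in> K p \<and> x0 \<in> K q \<longrightarrow>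
        U \<subseteq> fst (c p) \<inter> fst (c q) \<and> (\<forall>x\<in>U. \<forall>y\<in>U. \<forall>s t. E p s t x y \<longleftrightarrow> E q s t x y))" for p q
    proof (cases "x0 \<in> K p")
      case False
      then show ?thesis using patch(5)[of p] by (intro exI[of _ "- K p"]) auto
    next
      case p: True
      show ?thesis
      proof (cases "x0 \<in> K q")
        case True
        then have "x0 \<in> fst (c p)" "x0 \<in> fst (c q)" using p patch(6) by auto
        then obtain U where "open U" "x0 \<in> U" "U \<subseteq> fst (c p) \<inter> fst (c q)"
          "\<And>x y s t. x \<in> U \<Longrightarrow> y \<in> U \<Longrightarrow> E p s t x y \<longleftrightarrow> E q s t x y"
          using gradient_charts_compatible[OF patch(1)[of p] patch(1)[of q]] unfolding E_def by blast
        then show ?thesis using p True by (intro exI[of _ U]) auto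
      next
        case False
        then show ?thesis using p by (intro exI[of _ UNIV]) auto
      qed
    qed
    then obtain U where U: "\<And>p q. open (U p q)" "\<And>p q. x0 \<in> U p q"
      "\<And>p q. x0 \<notin> K p \<Longrightarrow> U p q \<inter> K p = {}"
      "\<And>p q. x0 \<in> K p \<Longrightarrow> x0 \<in> K q \<Longrightarrow> U p q \<subseteq> fst (c p) \<inter> fst (c q)"
      "\<And>p q x y s t. x0 \<in> K p \<Longrightarrow> x0 \<in> K q \<Longrightarrow> x \<in> U p q \<Longrightarrow> y \<in> U p q \<Longrightarrow> E p s t x y \<longleftrightarrow> E q s t x y"
      by metis
    define D where "D = (\<Inter>p\<in>I. \<Inter>q\<in>I. U p q)"
    have D: "open D" "x0 \<in> D" "\<And>p q. p \<in> I \<Longrightarrow> q \<in> I \<Longrightarrow> D \<subseteq> U p q"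
      unfolding D_def using I(1) U(1,2) by (auto intro!: open_INT)
    \<comment> \<open>Otherwise \<open>D\<close>, being contained in \<open>U q q\<close>, would
      miss \<open>K q\<close>.\<close>
    have DK: "x0 \<in> K q" if "q \<in> I" "x \<in> D" "x \<in> K q" for q x
      using U(3)[of q q] D(3)[OF that(1,1)] that(2,3) by blast
    obtain p where p: "p \<in> I" "x0 \<in> V p" using I(2) by blast
    then have pK: "x0 \<in> K p" using patch(4) by blast
    have Dc: "D \<subseteq> fst (c p)" using U(4)[OF pK pK] D(3)[OF p(1) p(1)] by blast
    obtain \<delta> N where N: "\<delta> > 0" "open N" "x0 \<in> N" "N \<subseteq> D"
      "\<And>s t x. s \<in> {0..1} \<Longrightarrow> t \<in> {0..1} \<Longrightarrow> \<bar>s - s0\<bar> < \<delta> \<Longrightarrow> \<bar>t - s0\<bar> < \<delta> \<Longrightarrow> x \<in> N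
      \<Longrightarrow> \<exists>y\<in>D. E p s t x y"
      using gradient_chart_solvable[OF patch(1)[of p] D(1,2) Dc s0] unfolding E_def by blast
    \<comment> \<open>A single chart decides: within \<open>D\<close> the relation in chart
      \<open>p\<close> is equivalent to the one in every chart \<open>q\<close> that
      \<open>rel\<close> may test.\<close>
    have relI: "rel s t x y" if "x \<in> D" "y \<in> D" "E p s t x y" for s t x y
      unfolding rel_def
    proof (intro ballI impI)
      fix q assume q: "q \<in> I" "x \<in> K q"
      have "x0 \<in> K q" by (rule DK[OF q(1) that(1) q(2)])
      then show "y \<in> fst (c q) \<and> E q s t x y"
        using U(4)[OF pK, of q] U(5)[OF pK, of q x y s t] D(3)[OF p(1) q(1)] that by blast
    qed
    have "\<exists>y. rel s t x y \<and> rel t s y x"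
      if "s \<in> {0..1}" "t \<in> {0..1}" "\<bar>s - s0\<bar> < \<delta>" "\<bar>t - s0\<bar> < \<delta>" "x \<in> N" for s t x
    proof -
      from N(5)[OF that] obtain y where y: "y \<in> D" "E p s t x y" by blast
      moreover have "x \<in> D" using that(5) N(4) by blast
      moreover have "E p t s y x" using y(2) by (simp add: E_def)
      ultimately show ?thesis using relI by blast
    qed
    then show ?thesis using N(1-3) by blast
  qed
  obtain N \<delta> where N: "\<And>x0. open (N x0)" "\<And>x0. x0 \<in> N x0" "\<And>x0. \<delta> x0 > 0"
    "\<And>x0 s t x. s \<in> {0..1} \<Longrightarrow> t \<in> {0..1} \<Longrightarrow> \<bar>s - s0\<bar> < \<delta> x0 \<Longrightarrow> \<bar>t - s0\<bar> < \<delta> x0 \<Longrightarrow> x \<in> N x0 \<Longrightarrow>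
      \<exists>y. rel s t x y \<and> rel t s y x"
    using loc by metis
  obtain J where J: "finite J" "(UNIV :: 'a set) \<subseteq> (\<Union>x\<in>J. N x)"
    using compactE_image[OF X, of UNIV N] N(1,2) by (metis UNIV_I UN_iff subsetI)
  \<comment> \<open>The inserted 1 keeps the minimum meaningful without discussing whether
    \<open>J\<close> is empty.\<close>
  define \<epsilon> where "\<epsilon> = Min (insert 1 (\<delta> ` J))"
  have \<epsilon>: "\<epsilon> > 0" "\<And>x. x \<in> J \<Longrightarrow> \<epsilon> \<le> \<delta> x" using J(1) N(3) by (auto simp: \<epsilon>_def)
  have ex: "\<exists>y. rel s t x y \<and> rel t s y x"
    if "s \<in> {0..1}" "t \<in> {0..1}" "\<bar>s - s0\<bar> < \<epsilon>" "\<bar>t - s0\<bar> < \<epsilon>" for s t x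
  proof -
    obtain x0 where x0: "x0 \<in> J" "x \<in> N x0" using J(2) by blast
    then show ?thesis using N(4)[OF that(1,2), of x0 x] that(3,4) \<epsilon>(2)[OF x0(1)] by auto
  qed
  \<comment> \<open>The sets \<open>V p\<close> cover the space, so \<open>rel\<close> imposes at
    least one equation at \<open>x\<close>, and injectivity of that gradient map determines
    \<open>y\<close>.\<close>
  have uniq: "y = y'" if s: "s \<in> {0..1}" and r: "rel s t x y" "rel s t x y'" for s t x y y'
  proof -
    obtain p where p: "p \<in> I" "x \<in> V p" using I(2) by blast
    then have "x \<in> K p" using patch(4) by blast
    then have *: "y \<in> fst (c p)" "E p s t x y" "y' \<in> fst (c p)" "E p s t x y'"
      using r p(1) by (auto simp: rel_def)
    note cc = gradient_chartD(6)[OF patch(1)[of p]]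
    have "snd (c p) y = snd (c p) y'"
      by (rule inj_onD[OF inj_F[OF patch(1)[of p] s]]) (use * chart_in_image[OF cc] in \<open>auto simp: E_def\<close>)
    then show "y = y'" using chart_inv_chart[OF cc] * by metis
  qed
  have aff: "affine_map A (dual_connection \<Gamma> (gt t)) (dual_connection \<Gamma> (gt s)) f"
    if st: "s \<in> {0..1}" "t \<in> {0..1}" and f: "\<And>x. rel s t x (f x)" for s t f
  proof -
    have m: "f z \<in> fst (c p) \<and> F (c p) (P p) s (snd (c p) (f z)) = F (c p) (P p) t (snd (c p) z)"
      if "p \<in> I" "z \<in> V p" for p z
      using f[of z] that patch(4) by (auto simp: rel_def E_def)
    have VF: "V p \<subseteq> fst (c p)" for p using patch(4,6) by blast
    note germ = gradient_matching_germ[OF patch(1) patch(2) VF m st]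
    have "continuous_on (\<Union>p\<in>I. V p) f"
      by (rule continuous_on_open_UN) (use patch(2) germ(1) in auto)
    then have "continuous_on UNIV f" using I(2) by (simp add: top.extremum_unique)
    moreover have "affine_germ (dual_connection \<Gamma> (gt t)) (dual_connection \<Gamma> (gt s)) f d e x"
      if "d \<in> A" "e \<in> A" "x \<in> fst d" "f x \<in> fst e" for d e x
    proof -
      obtain p where p: "p \<in> I" "x \<in> V p" using I(2) by blast
      show ?thesis
        by (rule affine_germ_change_charts[OF A \<Gamma> riemannian_gt[OF st(2)] riemannian_gt[OF st(1)] germ(2)[OF p(1) _ p(2)]])
          (use p m[OF p] VF gradient_chartD(1)[OF patch(1)] that in auto)
    qed
    ultimately show ?thesis by (simp add: affine_map_def)
  qed
  show ?thesis
  proof (rule that[OF \<epsilon>(1)])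
    fix s t assume st: "s \<in> {0..1}" "t \<in> {0..1}" "\<bar>s - s0\<bar> < \<epsilon>" "\<bar>t - s0\<bar> < \<epsilon>"
    obtain f where f: "\<And>x. rel s t x (f x)" "\<And>x. rel t s (f x) x"
      using ex[OF st] by metis
    obtain h where h: "\<And>x. rel t s x (h x)" "\<And>x. rel s t (h x) x"
      using ex[OF st(2,1,4,3)] by metis
    \<comment> \<open>Both \<open>x\<close> and \<open>h (f x)\<close> are related to
      \<open>f x\<close> by \<open>rel t s\<close>; likewise with the roles of \<open>f\<close> and
      \<open>h\<close> exchanged.\<close>
    have "h (f x) = x" "f (h x) = x" for x
      using uniq[OF st(2) h(1) f(2)] uniq[OF st(1) f(1) h(2)] by auto
    then have "h \<circ> f = id" "f \<circ> h = id" by (simp_all add: fun_eq_iff)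
    then show "affinely_equivalent A (dual_connection \<Gamma> (gt t)) (dual_connection \<Gamma> (gt s))"
      unfolding affinely_equivalent_def using aff[OF st(1,2) f(1)] aff[OF st(2,1) h(1)] by blast
  qed
qed

lemma dual_endpoints_equivalent:
  assumes X: "compact (UNIV :: 'a set)" and H: "hessian_metric A \<Gamma> g"
  shows "affinely_equivalent A (dual_connection \<Gamma> g) (dual_connection \<Gamma> g')"
proof -
  have "affinely_equivalent A (dual_connection \<Gamma> (gt 0)) (dual_connection \<Gamma> (gt 1))"
  proof (rule connected_equivalence_relation[where S = "{0..1::real}"
        and R = "\<lambda>s t. affinely_equivalent A (dual_connection \<Gamma> (gt s)) (dual_connection \<Gamma> (gt t))"])
    fix s0 :: real assume s0: "s0 \<in> {0..1}"
    obtain \<delta> where \<delta>: "\<delta> > 0"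
      "\<And>s t. s \<in> {0..1} \<Longrightarrow> t \<in> {0..1} \<Longrightarrow> \<bar>s - s0\<bar> < \<delta> \<Longrightarrow> \<bar>t - s0\<bar> < \<delta> \<Longrightarrow>
        affinely_equivalent A (dual_connection \<Gamma> (gt t)) (dual_connection \<Gamma> (gt s))"
      using dual_locally_constant[OF X H s0] by blast
    show "\<exists>T. openin (top_of_set {0..1}) T \<and> s0 \<in> T \<and>
        (\<forall>x\<in>T. affinely_equivalent A (dual_connection \<Gamma> (gt s0)) (dual_connection \<Gamma> (gt x)))"
      using \<delta> s0
      by (intro exI[of _ "{0..1} \<inter> ball s0 \<delta>"])
        (auto simp: openin_open_Int dist_real_def abs_minus_commute)
  qed (auto intro: affinely_equivalent_sym affinely_equivalent_trans[OF A])
  moreover have "gt 0 = g" "gt 1 = g'" by (simp_all add: gt_def fun_eq_iff)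
  ultimately show ?thesis by simp
qed

end

theorem corollary4p4:
  fixes A :: "('a::{t2_space,second_countable_topology}, 'n::finite) chart set"
    and \<Gamma> :: "('a, 'n) connection"
    and g g' :: "('a, 'n) metric"
    and \<phi> :: "'a \<Rightarrow> real"
  assumes "compact (UNIV :: 'a set)"
    and "smooth_structure A"
    and "affine_structure A \<Gamma>"
    and "hessian_metric A \<Gamma> g"
    and "hessian_metric A \<Gamma> g'"
    and "smooth_function A \<phi>"
    and "\<forall>c\<in>A. \<forall>y\<in>chart_image c. g c y - g' c y = cov_hessian \<Gamma> \<phi> c y"
  shows "\<exists>f. affine_isomorphism A (dual_connection \<Gamma> g) A (dual_connection \<Gamma> g') f"
proof -
  interpret hessian_segment A \<Gamma> g g' \<phi>
  proof
    show "smooth_structure A" by (rule assms(2))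
    show "is_connection A \<Gamma>" using assms(3) by (simp add: affine_structure_def)
    show "riemannian_metric A g" "riemannian_metric A g'"
      using assms(4,5) by (simp_all add: hessian_metric_def)
    show "smooth_function A \<phi>" by (rule assms(6))
    show "g c y - g' c y = cov_hessian \<Gamma> \<phi> c y" if "c \<in> A" "y \<in> chart_image c" for c y
      using assms(7) that by blast
  qed
  show ?thesis
    by (rule affine_isomorphism_if_equivalent[OF assms(2) dual_endpoints_equivalent[OF assms(1,4)]])
qed

end
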